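(* Let $k \geq 4$ be fixed and $\ell \geq 60k+12$. Then for all sufficiently large $n$, $$sat(K_k^n,C_{\ell}) \leq k(n-1) + 6 \left\lceil \frac{\ell}{5} \right\rceil.$$ Moreover, for $\ell \ge 60\cdot 3+12$ and all sufficiently large $n$, $sat(K_3^n, C_{\ell}) \leq 3n + 13 \left\lceil \frac{\ell}{5} \right\rceil$.
   Context: All graphs are finite, simple and undirected. $K_k^n$ denotes the complete $k$-partite graph with exactly $n$ vertices in each of its $k$ parts. $C_\ell$ denotes the cycle on $\ell$ vertices. For graphs $G$ and $F$, a spanning subgraph $H$ of $G$ is $F$-saturated relative to $G$ if $H$ contains no copy of $F$ but $H+e$ contains a copy of $F$ for every $e\in E(G)\setminus E(H)$; $sat(G,F)$ is the minimum number of edges of a graph that is $F$-saturated relative to $G$. *)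

theory Defs
  imports Complex_Main
begin

(* A graph is a pair (vertex set, edge set), each edge being a two-element set of vertices. *)
type_synonym 'a graph = "'a set \<times> 'a set set"

abbreviation verts :: "'a graph \<Rightarrow> 'a set" where
  "verts G \<equiv> fst G"

abbreviation edges :: "'a graph \<Rightarrow> 'a set set" where
  "edges G \<equiv> snd G"

definition simple_graph :: "'a graph \<Rightarrow> bool" where
  "simple_graph G \<longleftrightarrow>
     finite (verts G) \<and> (\<forall>e\<in>edges G. e \<subseteq> verts G \<and> card e = 2)"

definition spanning_subgraph :: "'a graph \<Rightarrow> 'a graph \<Rightarrow> bool" where
  "spanning_subgraph H G \<longleftrightarrow> verts H = verts G \<and> edges H \<subseteq> edges G"

definition add_edge :: "'a graph \<Rightarrow> 'a set \<Rightarrow> 'a graph" where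
  "add_edge H e = (verts H, insert e (edges H))"

(* Copies are subgraphs, not necessarily induced. *)
definition contains_copy :: "'a graph \<Rightarrow> 'b graph \<Rightarrow> bool" where
  "contains_copy H F \<longleftrightarrow>
     (\<exists>\<phi>. inj_on \<phi> (verts F) \<and> \<phi> ` verts F \<subseteq> verts H \<and> (\<forall>e\<in>edges F. \<phi> ` e \<in> edges H))"

definition saturated_in :: "'a graph \<Rightarrow> 'b graph \<Rightarrow> 'a graph \<Rightarrow> bool" where
  "saturated_in G F H \<longleftrightarrow>
     spanning_subgraph H G \<and> \<not> contains_copy H F \<and>
     (\<forall>e \<in> edges G - edges H. contains_copy (add_edge H e) F)"

(* The minimum is attained whenever F has an edge; see sat_attained below. *)
definition sat :: "'a graph \<Rightarrow> 'b graph \<Rightarrow> nat" where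
  "sat G F = (LEAST m. \<exists>H. saturated_in G F H \<and> card (edges H) = m)"

(* The vertex (i, j) is the j-th vertex of the i-th part. *)
definition complete_multipartite :: "nat \<Rightarrow> nat \<Rightarrow> (nat \<times> nat) graph" where
  "complete_multipartite k n =
     ({..<k} \<times> {..<n},
      {{u, v} | u v. u \<in> {..<k} \<times> {..<n} \<and> v \<in> {..<k} \<times> {..<n} \<and> fst u \<noteq> fst v})"

(* Only meaningful as a cycle for l at least 3. *)
definition cycle_graph :: "nat \<Rightarrow> nat graph" where
  "cycle_graph l = ({..<l}, {{i, (i + 1) mod l} | i. i < l})"

lemma simple_graph_complete_multipartite: "simple_graph (complete_multipartite k n)"
  unfolding simple_graph_def
proof (intro conjI ballI)
  show "finite (verts (complete_multipartite k n))"
    by (simp add: complete_multipartite_def)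
next
  fix e
  assume "e \<in> edges (complete_multipartite k n)"
  then obtain u v where uv: "e = {u, v}" "u \<in> {..<k} \<times> {..<n}" "v \<in> {..<k} \<times> {..<n}" "u \<noteq> v"
    unfolding complete_multipartite_def snd_conv by blast
  show "e \<subseteq> verts (complete_multipartite k n)"
    unfolding complete_multipartite_def fst_conv uv(1) using uv(2,3) by blast
  show "card e = 2"
    using uv(1,4) by simp
qed

lemma simple_graph_cycle_graph:
  assumes "l \<ge> 3"
  shows "simple_graph (cycle_graph l)"
proof -
  have "i \<noteq> Suc i mod l" if "i < l" for i
    using that assms by (cases "Suc i = l") auto
  then show ?thesis
    using assms by (auto simp: simple_graph_def cycle_graph_def card_insert_if)
qed

lemma saturated_in_exists:
  assumes G: "simple_graph G" and F: "edges F \<noteq> {}"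
  shows "\<exists>H. saturated_in G F H"
proof -
  let ?A = "{E. E \<subseteq> edges G \<and> \<not> contains_copy (verts G, E) F}"
  have "edges G \<subseteq> Pow (verts G)"
    using G by (auto simp: simple_graph_def)
  then have "finite (edges G)"
    using G by (meson finite_Pow_iff finite_subset simple_graph_def)
  then have "finite ?A"
    by simp
  moreover have "?A \<noteq> {}"
    using F by (auto simp: contains_copy_def)
  ultimately have "\<exists>M\<in>?A. \<forall>E\<in>?A. M \<subseteq> E \<longrightarrow> M = E"
    by (rule finite_has_maximal)
  then obtain M where M: "M \<in> ?A" and max: "\<forall>E\<in>?A. M \<subseteq> E \<longrightarrow> M = E"
    by (elim bexE)
  have "contains_copy (verts G, insert e M) F" if "e \<in> edges G - M" for e
  proof (rule ccontr)
    assume "\<not> contains_copy (verts G, insert e M) F"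
    then have "insert e M \<in> ?A"
      using M that by auto
    then show False
      using bspec[OF max, of "insert e M"] that by auto
  qed
  then have "saturated_in G F (verts G, M)"
    using M by (simp add: saturated_in_def spanning_subgraph_def add_edge_def)
  then show ?thesis ..
qed

lemma sat_attained:
  assumes "simple_graph G" and "edges F \<noteq> {}"
  shows "\<exists>H. saturated_in G F H \<and> card (edges H) = sat G F"
proof -
  obtain H where "saturated_in G F H"
    using saturated_in_exists[OF assms] by (elim exE)
  then have "\<exists>H'. saturated_in G F H' \<and> card (edges H') = card (edges H)"
    by (intro exI[of _ H]) simp
  then show ?thesis
    unfolding sat_def by (rule LeastI)
qed

end

theory Submission imports Defs
begin

text \<open>
  The saturated graph is a core on exactly \<open>l\<close> vertices with all other vertices attached as leaves,
  those of part \<open>i\<close> to one core vertex \<open>w i\<close>. It suffices that the core is not Hamiltonian, that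
  non-adjacent core vertices from different parts are joined by a Hamiltonian path of the core, that
  \<open>w i\<close> is joined to every other core vertex outside part \<open>i\<close> by a path on \<open>l - 1\<close> vertices, and
  to the other \<open>w j\<close> by paths on \<open>l - 2\<close> vertices.

  The core is a closed necklace of \<open>m\<close> blobs, where \<open>l = 5 m + 1 + r\<close> with \<open>r \<le> 4\<close>. A blob is
  complete tripartite with classes \<open>{A, B}\<close>, \<open>{C}\<close> and \<open>{D}\<close>, and \<open>r\<close> of the blobs have an
  additional vertex \<open>E\<close> in the class of \<open>C\<close>. The link \<open>T i\<close> joins the \<open>B\<close> of one blob to the \<open>A\<close>
  of the next, and a hub \<open>H\<close> is adjacent to every \<open>C\<close>. Only three edges leave a blob, so a
  Hamiltonian cycle visits each of the \<open>m\<close> blobs once and cannot separate the \<open>m + 1\<close> pairwise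
  non-adjacent vertices \<open>T i\<close> and \<open>H\<close>. A new edge lets the cycle visit the blobs at its ends once
  more, and this makes it Hamiltonian. Paths are shortened by omitting \<open>D\<close> in a blob that is
  traversed from \<open>A\<close> to \<open>B\<close>, and all but a few cases are related by the rotations and the
  reflection of the necklace. The core has at most \<open>8 m + 3 r\<close> edges.
\<close>

section \<open>Paths and cycles\<close>

text \<open>The index \<open>S\<close> is the exact vertex set of the path, so concatenation is a
  disjoint union and a Hamiltonian path is the case where \<open>S\<close> is everything.\<close>

definition path_on :: "('v \<Rightarrow> 'v \<Rightarrow> bool) \<Rightarrow> 'v set \<Rightarrow> 'v \<Rightarrow> 'v \<Rightarrow> bool" where
  "path_on R S u v \<longleftrightarrow>
     (\<exists>xs. xs \<noteq> [] \<and> hd xs = u \<and> last xs = v \<and> set xs = S \<and> distinct xs \<and> successively R xs)"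

lemma path_onI:
  "xs \<noteq> [] \<Longrightarrow> hd xs = u \<Longrightarrow> last xs = v \<Longrightarrow> set xs = S \<Longrightarrow> distinct xs \<Longrightarrow> successively R xs \<Longrightarrow> path_on R S u v"
  unfolding path_on_def by blast

lemma path_on_single: "path_on R {u} u u"
  unfolding path_on_def by (rule exI[of _ "[u]"]) simp

lemma path_on_append:
  assumes "path_on R S u v" "path_on R S' u' v'" "R v u'" "S \<inter> S' = {}"
  shows "path_on R (S \<union> S') u v'"
proof -
  obtain xs ys where xs: "xs \<noteq> []" "hd xs = u" "last xs = v" "set xs = S" "distinct xs" "successively R xs"
    and ys: "ys \<noteq> []" "hd ys = u'" "last ys = v'" "set ys = S'" "distinct ys" "successively R ys"
    using assms(1,2) unfolding path_on_def by blast
  then have "xs @ ys \<noteq> [] \<and> hd (xs @ ys) = u \<and> last (xs @ ys) = v' \<and> set (xs @ ys) = S \<union> S' \<and>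
      distinct (xs @ ys) \<and> successively R (xs @ ys)"
    using assms(3,4) by (simp add: successively_append_iff)
  then show ?thesis
    unfolding path_on_def by blast
qed

lemma path_on_rev:
  assumes "symp R" "path_on R S u v"
  shows "path_on R S v u"
proof -
  obtain xs where xs: "xs \<noteq> []" "hd xs = u" "last xs = v" "set xs = S" "distinct xs" "successively R xs"
    using assms(2) unfolding path_on_def by blast
  have "successively R (rev xs)"
    using xs(6) assms(1) by (auto simp: successively_rev intro: successively_mono dest: sympD)
  then show ?thesis
    using xs unfolding path_on_def by (intro exI[of _ "rev xs"]) (simp add: hd_rev last_rev)
qed

lemma path_on_image:
  assumes "path_on R S u v" "inj_on f S" "\<And>x y. x \<in> S \<Longrightarrow> y \<in> S \<Longrightarrow> R x y \<Longrightarrow> R' (f x) (f y)"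
  shows "path_on R' (f ` S) (f u) (f v)"
proof -
  obtain xs where xs: "xs \<noteq> []" "hd xs = u" "last xs = v" "set xs = S" "distinct xs" "successively R xs"
    using assms(1) unfolding path_on_def by blast
  have "successively R' (map f xs)"
    unfolding successively_map by (rule successively_mono[OF xs(6)]) (use assms(3) xs(4) in auto)
  then show ?thesis
    using xs assms(2) unfolding path_on_def
    by (intro exI[of _ "map f xs"]) (simp add: hd_map last_map distinct_map)
qed

lemma contains_cycle_graph:
  assumes "length zs \<ge> 3" "distinct zs" "set zs \<subseteq> verts G"
    and "successively (\<lambda>x y. {x, y} \<in> edges G) zs" "{last zs, hd zs} \<in> edges G"
  shows "contains_copy G (cycle_graph (length zs))"
proof -
  have ne: "zs \<noteq> []" using assms(1) by auto
  have "{zs ! i, zs ! (Suc i mod length zs)} \<in> edges G" if "i < length zs" for i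
  proof (cases "Suc i = length zs")
    case True
    then have "zs ! i = last zs" "zs ! 0 = hd zs"
      using ne by (auto simp: last_conv_nth hd_conv_nth simp flip: True)
    then show ?thesis using assms(5) True by simp
  next
    case False
    then show ?thesis using that assms(4) by (simp add: successively_conv_nth)
  qed
  then show ?thesis
    unfolding contains_copy_def cycle_graph_def using assms(2,3)
    by (intro exI[of _ "(!) zs"]) (auto simp: inj_on_nth subset_iff)
qed

text \<open>For finite \<open>V\<close> such a \<open>\<sigma>\<close> is a spanning union of
  disjoint cycles of length at least 3. A Hamiltonian cycle yields one through its successor map, so
  excluding these maps is at least as strong, and permutations are convenient for counting.\<close>

definition hamiltonian_on :: "('v \<Rightarrow> 'v \<Rightarrow> bool) \<Rightarrow> 'v set \<Rightarrow> bool" where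
  "hamiltonian_on R V \<longleftrightarrow>
     (\<exists>\<sigma>. bij_betw \<sigma> V V \<and> (\<forall>v\<in>V. R v (\<sigma> v) \<and> \<sigma> (\<sigma> v) \<noteq> v))"

definition long_path :: "('v \<Rightarrow> 'v \<Rightarrow> bool) \<Rightarrow> 'v set \<Rightarrow> nat \<Rightarrow> 'v \<Rightarrow> 'v \<Rightarrow> bool" where
  "long_path R V q u v \<longleftrightarrow> (\<exists>S\<subseteq>V. card S = q \<and> path_on R S u v)"

lemma long_path_rev: "symp R \<Longrightarrow> long_path R V q u v \<Longrightarrow> long_path R V q v u"
  unfolding long_path_def using path_on_rev by metis

lemma long_path_list:
  assumes "long_path R V q u v"
  obtains xs where "xs \<noteq> []" "hd xs = u" "last xs = v" "set xs \<subseteq> V" "distinct xs" "length xs = q"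
    "successively R xs"
  using assms unfolding long_path_def path_on_def by (metis distinct_card)

lemma Suc_mod_bij: "0 < l \<Longrightarrow> bij_betw (\<lambda>i. Suc i mod l) {..<l} {..<l}"
proof -
  assume l: "0 < l"
  have "inj_on (\<lambda>i. Suc i mod l) {..<l}"
    by (auto simp: inj_on_def mod_Suc split: if_splits)
  moreover have "(\<lambda>i. Suc i mod l) ` {..<l} \<subseteq> {..<l}" using l by auto
  ultimately show ?thesis by (simp add: bij_betw_def endo_inj_surj)
qed

section \<open>Attaching leaves to a core\<close>

text \<open>Vertices outside the core have degree 1, so a cycle on \<open>l\<close> vertices lies in
  the core and spans it. An added edge is closed to a cycle by a core path on \<open>l\<close>,
  \<open>l - 1\<close> or \<open>l - 2\<close> vertices, according to whether none, one or both of
  its ends are leaves. Each leaf contributes one edge.\<close>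

lemma sat_le_core:
  fixes V :: "'v set" and adj :: "'v \<Rightarrow> 'v \<Rightarrow> bool" and col :: "'v \<Rightarrow> nat" and w :: "nat \<Rightarrow> 'v"
  assumes fin: "finite V" and l: "card V = l" "l \<ge> 3" and n: "l \<le> n"
    and sym: "symp adj"
    and col: "\<And>v. v \<in> V \<Longrightarrow> col v < k"
    and proper: "\<And>x y. adj x y \<Longrightarrow> col x \<noteq> col y"
    and w: "\<And>i. i < k \<Longrightarrow> w i \<in> V \<and> col (w i) \<noteq> i"
    and nonham: "\<not> hamiltonian_on adj V"
    and core_core: "\<And>x y. x \<in> V \<Longrightarrow> y \<in> V \<Longrightarrow> col x \<noteq> col y \<Longrightarrow> \<not> adj x y \<Longrightarrow> long_path adj V l x y"
    and core_leaf: "\<And>i x. i < k \<Longrightarrow> x \<in> V \<Longrightarrow> col x \<noteq> i \<Longrightarrow> x \<noteq> w i \<Longrightarrow> long_path adj V (l - 1) (w i) x"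
    and leaf_leaf: "\<And>i j. i < k \<Longrightarrow> j < k \<Longrightarrow> i \<noteq> j \<Longrightarrow> long_path adj V (l - 2) (w i) (w j)"
  shows "sat (complete_multipartite k n) (cycle_graph l)
           \<le> card {{x, y} | x y. x \<in> V \<and> y \<in> V \<and> adj x y} + (k * n - l)"
proof -
  let ?K = "complete_multipartite k n"
  define X where "X = {..<k} \<times> {..<n}"
  have vK: "verts ?K = X" by (simp add: complete_multipartite_def X_def)
  have eK: "edges ?K = {{u, v} | u v. u \<in> X \<and> v \<in> X \<and> fst u \<noteq> fst v}"
    by (simp add: complete_multipartite_def X_def)
  obtain f where f: "bij_betw f V {..<l}"
    using ex_bij_betw_finite_nat[OF fin] l by (auto simp: atLeast0LessThan)
  \<comment> \<open>The second coordinate numbers the core across all colours, which makes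
    \<open>\<epsilon>\<close> injective; it stays in range because \<open>l \<le> n\<close>.\<close>
  define \<epsilon> where "\<epsilon> v = (col v, f v)" for v
  have inj: "inj_on \<epsilon> V"
    using f by (auto simp: \<epsilon>_def inj_on_def bij_betw_def)
  have \<epsilon>X: "\<epsilon> v \<in> X" if "v \<in> V" for v
    using that bij_betwE[OF f] n col by (force simp: \<epsilon>_def X_def)
  have fst\<epsilon>: "fst (\<epsilon> v) = col v" for v by (simp add: \<epsilon>_def)
  define E1 where "E1 = {{x, y} | x y. x \<in> V \<and> y \<in> V \<and> adj x y}"
  define leaf where "leaf p = {p, \<epsilon> (w (fst p))}" for p
  define H where "H = (X, (`) \<epsilon> ` E1 \<union> leaf ` (X - \<epsilon> ` V))"
  have vH: "verts H = X" by (simp add: H_def)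
  have core_edge: "{\<epsilon> x, \<epsilon> y} \<in> edges H" if "x \<in> V" "y \<in> V" "adj x y" for x y
  proof -
    have "{\<epsilon> x, \<epsilon> y} = \<epsilon> ` {x, y}" by auto
    then show ?thesis using that unfolding H_def E1_def by (auto intro!: imageI)
  qed
  have leaf_edge: "{p, \<epsilon> (w (fst p))} \<in> edges H" if "p \<in> X - \<epsilon> ` V" for p
    using that by (auto simp: H_def leaf_def)
  have edge_cases: "(\<exists>x\<in>V. \<exists>y\<in>V. u = \<epsilon> x \<and> v = \<epsilon> y \<and> adj x y)
      \<or> u \<in> X - \<epsilon> ` V \<and> v = \<epsilon> (w (fst u)) \<or> v \<in> X - \<epsilon> ` V \<and> u = \<epsilon> (w (fst v))"
    if e: "{u, v} \<in> edges H" for u v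
  proof -
    consider x y where "x \<in> V" "y \<in> V" "adj x y" "{u, v} = {\<epsilon> x, \<epsilon> y}"
      | p where "p \<in> X - \<epsilon> ` V" "{u, v} = {p, \<epsilon> (w (fst p))}"
      using e by (auto simp: H_def E1_def leaf_def)
    then show ?thesis
      by cases (use sympD[OF sym] in \<open>auto simp: doubleton_eq_iff\<close>)
  qed
  have wX: "w (fst p) \<in> V" "col (w (fst p)) \<noteq> fst p" if "p \<in> X" for p
    using that w[of "fst p"] by (auto simp: X_def)
  have edge_leaf: "v = \<epsilon> (w (fst u))" if "{u, v} \<in> edges H" "u \<notin> \<epsilon> ` V" for u v
    using edge_cases[OF that(1)] that(2) wX(1) by blast
  have "edges H \<subseteq> edges ?K"
  proof
    fix e assume e: "e \<in> edges H"
    have "(\<exists>x y. e = {\<epsilon> x, \<epsilon> y}) \<or> (\<exists>p. e = leaf p)"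
      using e by (auto simp: H_def E1_def)
    then obtain u v where uv: "e = {u, v}"
      unfolding leaf_def by blast
    show "e \<in> edges ?K"
      using edge_cases[OF e[unfolded uv]] proper wX \<epsilon>X sympD[OF sym] fst\<epsilon>
      unfolding eK uv by (smt (verit) DiffD1 mem_Collect_eq insert_commute)
  qed
  then have span: "spanning_subgraph H ?K"
    by (simp add: spanning_subgraph_def vK vH)
  have free: "\<not> contains_copy H (cycle_graph l)"
  proof
    assume "contains_copy H (cycle_graph l)"
    then obtain \<phi> where \<phi>: "inj_on \<phi> {..<l}" "\<phi> ` {..<l} \<subseteq> X"
      and e: "\<And>e. e \<in> edges (cycle_graph l) \<Longrightarrow> \<phi> ` e \<in> edges H"
      unfolding contains_copy_def cycle_graph_def by (auto simp: vH)
    have \<phi>e: "{\<phi> i, \<phi> (Suc i mod l)} \<in> edges H" if "i < l" for i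
    proof -
      have "{i, Suc i mod l} \<in> edges (cycle_graph l)"
        using that by (auto simp: cycle_graph_def)
      from e[OF this] show ?thesis by simp
    qed
    have next_ne: "Suc (Suc i mod l) mod l \<noteq> i" "Suc i mod l < l" if "i < l" for i
      using that l(2) by (auto simp: mod_Suc)
    \<comment> \<open>A leaf has a single neighbour, whereas its predecessor and successor on the
      cycle differ because \<open>l \<ge> 3\<close>.\<close>
    have in_core: "\<phi> i \<in> \<epsilon> ` V" if i: "i < l" for i
    proof (rule ccontr)
      assume no: "\<phi> i \<notin> \<epsilon> ` V"
      have "i \<in> (\<lambda>i. Suc i mod l) ` {..<l}"
        using Suc_mod_bij[of l] l(2) i by (simp add: bij_betw_def)
      then obtain j where j: "j < l" "Suc j mod l = i" by auto
      have "\<phi> j = \<epsilon> (w (fst (\<phi> i)))"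
        using \<phi>e[OF j(1)] no j(2) by (intro edge_leaf) (auto simp: insert_commute)
      moreover have "\<phi> (Suc i mod l) = \<epsilon> (w (fst (\<phi> i)))"
        using \<phi>e[OF i] no by (rule edge_leaf)
      ultimately have "j = Suc i mod l"
        using inj_onD[OF \<phi>(1), of j "Suc i mod l"] j(1) next_ne(2)[OF i] by simp
      then show False using next_ne(1)[OF j(1)] j(2) by simp
    qed
    define \<psi> where "\<psi> i = inv_into V \<epsilon> (\<phi> i)" for i
    have \<psi>V: "\<psi> i \<in> V" "\<epsilon> (\<psi> i) = \<phi> i" if "i < l" for i
      using in_core[OF that] by (auto simp: \<psi>_def inv_into_into f_inv_into_f)
    have "inj_on \<psi> {..<l}"
      using \<phi>(1) \<psi>V(2) by (metis (mono_tags, lifting) inj_on_def lessThan_iff)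
    moreover from this have "\<psi> ` {..<l} = V"
      using \<psi>V(1) l fin by (intro card_subset_eq) (auto simp: card_image)
    ultimately have \<psi>b: "bij_betw \<psi> {..<l} V"
      by (simp add: bij_betw_def)
    have \<psi>adj: "adj (\<psi> i) (\<psi> (Suc i mod l))" if i: "i < l" for i
    proof -
      have "\<exists>x\<in>V. \<exists>y\<in>V. \<phi> i = \<epsilon> x \<and> \<phi> (Suc i mod l) = \<epsilon> y \<and> adj x y"
        using edge_cases[OF \<phi>e[OF i]] in_core[OF i] in_core[OF next_ne(2)[OF i]] by auto
      then show ?thesis
        using inj by (auto simp: \<psi>_def inv_into_f_f)
    qed
    define \<sigma> where "\<sigma> = \<psi> \<circ> (\<lambda>i. Suc i mod l) \<circ> inv_into {..<l} \<psi>"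
    have "bij_betw \<sigma> V V"
      unfolding \<sigma>_def
      by (rule bij_betw_trans[OF bij_betw_inv_into[OF \<psi>b]], rule bij_betw_trans[OF Suc_mod_bij \<psi>b])
        (use l(2) in simp)
    moreover have \<sigma>: "\<sigma> (\<psi> i) = \<psi> (Suc i mod l)" if "i < l" for i
      using that \<psi>b by (simp add: \<sigma>_def bij_betw_def inv_into_f_f)
    have "adj v (\<sigma> v) \<and> \<sigma> (\<sigma> v) \<noteq> v" if v: "v \<in> V" for v
    proof -
      obtain i where i: "i < l" "v = \<psi> i"
        using v \<psi>b by (auto simp: bij_betw_def)
      have "\<sigma> (\<sigma> v) = \<psi> (Suc (Suc i mod l) mod l)"
        using \<sigma> i next_ne(2) by simp
      then show ?thesis
        using i \<sigma> \<psi>adj next_ne[OF i(1)] \<psi>b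
        by (metis bij_betw_def inj_onD lessThan_iff mod_less_divisor next_ne(2))
    qed
    ultimately have "hamiltonian_on adj V"
      unfolding hamiltonian_on_def by blast
    then show False using nonham by simp
  qed
  have list_edges: "successively (\<lambda>x y. {x, y} \<in> edges (add_edge H e)) (map \<epsilon> xs)"
    if "successively adj xs" "set xs \<subseteq> V" for xs e
    unfolding successively_map
    by (rule successively_mono[OF that(1)]) (use that(2) core_edge in \<open>auto simp: add_edge_def\<close>)
  \<comment> \<open>By symmetry, if exactly one end of the new edge is a leaf, that end is called
    \<open>u\<close>.\<close>
  have add: "contains_copy (add_edge H {u, v}) (cycle_graph l)"
    if uX: "u \<in> X" and vX: "v \<in> X" and uv: "fst u \<noteq> fst v" "{u, v} \<notin> edges H"
      and sides: "v \<in> \<epsilon> ` V \<or> u \<notin> \<epsilon> ` V" for u v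
  proof -
    let ?G = "add_edge H {u, v}"
    have vG: "verts ?G = X" by (simp add: add_edge_def vH)
    have eG: "edges ?G = insert {u, v} (edges H)" by (simp add: add_edge_def)
    have "\<exists>zs. length zs = l \<and> distinct zs \<and> set zs \<subseteq> X \<and> hd zs = u \<and> last zs = v \<and>
        successively (\<lambda>x y. {x, y} \<in> edges ?G) zs"
    proof -
      consider (cc) x y where "x \<in> V" "y \<in> V" "u = \<epsilon> x" "v = \<epsilon> y"
        | (cl) y where "u \<notin> \<epsilon> ` V" "y \<in> V" "v = \<epsilon> y"
        | (ll) "u \<notin> \<epsilon> ` V" "v \<notin> \<epsilon> ` V"
        using sides by blast
      then show ?thesis
      proof cases
        case cc
        then have "long_path adj V l x y"
          using core_core core_edge uv fst\<epsilon> by auto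
        then obtain xs where "xs \<noteq> []" "hd xs = x" "last xs = y" "set xs \<subseteq> V" "distinct xs"
            "length xs = l" "successively adj xs"
          by (rule long_path_list)
        then show ?thesis
          using list_edges[of xs] cc \<epsilon>X inj_on_subset[OF inj]
          by (intro exI[of _ "map \<epsilon> xs"]) (auto simp: hd_map last_map distinct_map)
      next
        case cl
        have "y \<noteq> w (fst u)"
          using leaf_edge[of u] cl uX uv(2) by auto
        then have "long_path adj V (l - 1) (w (fst u)) y"
          using cl uv fst\<epsilon> uX by (intro core_leaf) (auto simp: X_def)
        then obtain xs where xs: "xs \<noteq> []" "hd xs = w (fst u)" "last xs = y" "set xs \<subseteq> V" "distinct xs"
            "length xs = l - 1" "successively adj xs"
          by (rule long_path_list)
        have "{u, \<epsilon> (w (fst u))} \<in> edges ?G"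
          using leaf_edge[of u] cl uX eG by auto
        then show ?thesis
          using list_edges[OF xs(7,4), of "{u, v}"] xs(1-6) cl \<epsilon>X inj_on_subset[OF inj xs(4)] uX l(2)
          by (intro exI[of _ "u # map \<epsilon> xs"])
            (auto simp: hd_map last_map distinct_map successively_Cons)
      next
        case ll
        have "long_path adj V (l - 2) (w (fst u)) (w (fst v))"
          using uv uX vX by (intro leaf_leaf) (auto simp: X_def)
        then obtain xs where xs: "xs \<noteq> []" "hd xs = w (fst u)" "last xs = w (fst v)" "set xs \<subseteq> V"
            "distinct xs" "length xs = l - 2" "successively adj xs"
          by (rule long_path_list)
        have "{u, \<epsilon> (w (fst u))} \<in> edges ?G" "{\<epsilon> (w (fst v)), v} \<in> edges ?G"
          using leaf_edge[of u] leaf_edge[of v] ll uX vX eG by (auto simp: insert_commute)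
        then show ?thesis
          using list_edges[OF xs(7,4), of "{u, v}"] xs(1-6) ll \<epsilon>X inj_on_subset[OF inj xs(4)] uX vX l(2) uv(1)
          by (intro exI[of _ "u # map \<epsilon> xs @ [v]"])
            (auto simp: hd_map last_map distinct_map successively_Cons successively_append_iff)
      qed
    qed
    then obtain zs where zs: "length zs = l" "distinct zs" "set zs \<subseteq> X" "hd zs = u" "last zs = v"
        "successively (\<lambda>x y. {x, y} \<in> edges ?G) zs"
      by blast
    have "{last zs, hd zs} \<in> edges ?G"
      using zs by (simp add: eG insert_commute)
    then show ?thesis
      using contains_cycle_graph[of zs ?G] zs l(2) vG by simp
  qed
  have "saturated_in ?K (cycle_graph l) H"
    unfolding saturated_in_def
  proof (intro conjI ballI span free)
    fix e assume "e \<in> edges ?K - edges H"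
    then obtain u v where uv: "e = {u, v}" "u \<in> X" "v \<in> X" "fst u \<noteq> fst v" "{u, v} \<notin> edges H"
      by (auto simp: eK)
    show "contains_copy (add_edge H e) (cycle_graph l)"
      using add[of u v] add[of v u] uv by (metis insert_commute)
  qed
  then have "sat ?K (cycle_graph l) \<le> card (edges H)"
    unfolding sat_def by (intro Least_le) blast
  also have "\<dots> \<le> card ((`) \<epsilon> ` E1) + card (leaf ` (X - \<epsilon> ` V))"
    unfolding H_def by (simp add: card_Un_le)
  also have "\<dots> \<le> card E1 + card (X - \<epsilon> ` V)"
  proof (intro add_mono card_image_le)
    have "E1 \<subseteq> Pow V" by (auto simp: E1_def)
    then show "finite E1" using fin by (simp add: finite_subset)
    show "finite (X - \<epsilon> ` V)" by (simp add: X_def)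
  qed
  also have "card (X - \<epsilon> ` V) = k * n - l"
  proof -
    have "\<epsilon> ` V \<subseteq> X"
      using \<epsilon>X by blast
    then show ?thesis
      using inj fin l by (simp add: card_Diff_subset card_image X_def)
  qed
  finally show ?thesis
    by (simp add: E1_def)
qed

section \<open>The necklace\<close>

datatype bead = T nat | A nat | B nat | C nat | D nat | E nat | H

text \<open>Each edge is listed in one direction only, so edges are enumerated once and symmetries
  need checking in one direction; \<open>adj\<close> symmetrises.\<close>

fun arc :: "nat \<Rightarrow> bead \<Rightarrow> bead \<Rightarrow> bool" where
  "arc m (T i) (A j) \<longleftrightarrow> i = j"
| "arc m (B i) (T j) \<longleftrightarrow> j = Suc i mod m"
| "arc m (C i) H \<longleftrightarrow> True"
| "arc m (A i) (C j) \<longleftrightarrow> i = j"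
| "arc m (A i) (D j) \<longleftrightarrow> i = j"
| "arc m (A i) (E j) \<longleftrightarrow> i = j"
| "arc m (B i) (C j) \<longleftrightarrow> i = j"
| "arc m (B i) (D j) \<longleftrightarrow> i = j"
| "arc m (B i) (E j) \<longleftrightarrow> i = j"
| "arc m (C i) (D j) \<longleftrightarrow> i = j"
| "arc m (D i) (E j) \<longleftrightarrow> i = j"
| "arc m _ _ \<longleftrightarrow> False"

definition adj :: "nat \<Rightarrow> bead \<Rightarrow> bead \<Rightarrow> bool" where
  "adj m x y \<longleftrightarrow> arc m x y \<or> arc m y x"

lemma symp_adj: "symp (adj m)"
  by (auto simp: symp_def adj_def)

text \<open>Three colours suffice: the core lies in the first three parts, and all further parts
  consist of leaves.\<close>

fun colour :: "bead \<Rightarrow> nat" where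
  "colour (T i) = 0"
| "colour (A i) = 1"
| "colour (B i) = 1"
| "colour (C i) = 2"
| "colour (D i) = 0"
| "colour (E i) = 2"
| "colour H = 0"

text \<open>The path arguments also need necklaces in which some of the beads \<open>D i\<close> are missing: a
  Hamiltonian path of such a necklace is a slightly shorter path of the full one. The predicates
  \<open>P\<close> and \<open>Q\<close> say which of the \<open>D i\<close> and \<open>E i\<close> are present.\<close>

definition blob :: "(nat \<Rightarrow> bool) \<Rightarrow> (nat \<Rightarrow> bool) \<Rightarrow> nat \<Rightarrow> bead set" where
  "blob P Q i = {A i, B i, C i} \<union> (if P i then {D i} else {}) \<union> (if Q i then {E i} else {})"

definition necklace :: "nat \<Rightarrow> (nat \<Rightarrow> bool) \<Rightarrow> (nat \<Rightarrow> bool) \<Rightarrow> bead set" where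
  "necklace m P Q = insert H (T ` {..<m} \<union> (\<Union>i<m. blob P Q i))"

text \<open>A stretch from the link \<open>T p\<close> to the link \<open>T q\<close>. With
  \<open>q < m\<close> it does not wrap around, which confines arithmetic modulo \<open>m\<close> to
  the one edge from the last blob to \<open>T 0\<close>.\<close>

definition seg :: "(nat \<Rightarrow> bool) \<Rightarrow> (nat \<Rightarrow> bool) \<Rightarrow> nat \<Rightarrow> nat \<Rightarrow> bead set" where
  "seg P Q p q = T ` {p..q} \<union> (\<Union>i\<in>{p..<q}. blob P Q i)"

lemma proper_colour: "adj m x y \<Longrightarrow> colour x \<noteq> colour y"
  by (cases x; cases y) (auto simp: adj_def)

lemma blob_simps:
  "T j \<notin> blob P Q i" "H \<notin> blob P Q i"
  "A j \<in> blob P Q i \<longleftrightarrow> j = i" "B j \<in> blob P Q i \<longleftrightarrow> j = i" "C j \<in> blob P Q i \<longleftrightarrow> j = i"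
  "D j \<in> blob P Q i \<longleftrightarrow> j = i \<and> P i" "E j \<in> blob P Q i \<longleftrightarrow> j = i \<and> Q i"
  by (auto simp: blob_def)

lemma necklace_simps:
  "H \<in> necklace m P Q" "T i \<in> necklace m P Q \<longleftrightarrow> i < m"
  "A i \<in> necklace m P Q \<longleftrightarrow> i < m" "B i \<in> necklace m P Q \<longleftrightarrow> i < m"
  "C i \<in> necklace m P Q \<longleftrightarrow> i < m" "D i \<in> necklace m P Q \<longleftrightarrow> i < m \<and> P i"
  "E i \<in> necklace m P Q \<longleftrightarrow> i < m \<and> Q i"
  by (auto simp: necklace_def blob_simps)

lemma seg_simps:
  "H \<notin> seg P Q p q" "T i \<in> seg P Q p q \<longleftrightarrow> p \<le> i \<and> i \<le> q"
  "A i \<in> seg P Q p q \<longleftrightarrow> p \<le> i \<and> i < q" "B i \<in> seg P Q p q \<longleftrightarrow> p \<le> i \<and> i < q"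
  "C i \<in> seg P Q p q \<longleftrightarrow> p \<le> i \<and> i < q" "D i \<in> seg P Q p q \<longleftrightarrow> p \<le> i \<and> i < q \<and> P i"
  "E i \<in> seg P Q p q \<longleftrightarrow> p \<le> i \<and> i < q \<and> Q i"
  by (auto simp: seg_def blob_simps)

lemma bead_set_eqI:
  assumes "H \<in> S \<longleftrightarrow> H \<in> S'" "\<And>i. T i \<in> S \<longleftrightarrow> T i \<in> S'" "\<And>i. A i \<in> S \<longleftrightarrow> A i \<in> S'"
    "\<And>i. B i \<in> S \<longleftrightarrow> B i \<in> S'" "\<And>i. C i \<in> S \<longleftrightarrow> C i \<in> S'" "\<And>i. D i \<in> S \<longleftrightarrow> D i \<in> S'"
    "\<And>i. E i \<in> S \<longleftrightarrow> E i \<in> S'"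
  shows "S = S'"
  by (rule set_eqI) (metis assms bead.exhaust)

text \<open>Most long paths treat just two blobs specially. A rotation makes one of them the last
  blob \<open>M\<close>; cutting there and at blob \<open>j\<close> leaves two stretches that are
  traversed straight.\<close>

lemma necklace_split:
  assumes "j < M"
  shows "necklace (Suc M) P Q = seg P Q 0 j \<union> blob P Q j \<union> seg P Q (Suc j) M \<union> blob P Q M \<union> {H}"
proof -
  have *: "{..<Suc M} = {0..j} \<union> {Suc j..M}" "{..<Suc M} = {0..<j} \<union> {j} \<union> {Suc j..<M} \<union> {M}"
    using assms by auto
  have "T ` {..<Suc M} = T ` {0..j} \<union> T ` {Suc j..M}"
    unfolding *(1) by blast
  moreover have "(\<Union>i<Suc M. blob P Q i) = (\<Union>i\<in>{0..<j}. blob P Q i) \<union> blob P Q j \<union> (\<Union>i\<in>{Suc j..<M}. blob P Q i) \<union> blob P Q M"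
    unfolding *(2) by blast
  ultimately show ?thesis
    unfolding necklace_def seg_def by (simp only:) blast
qed

lemma necklace_split_last:
  "necklace (Suc M) P Q = seg P Q 0 M \<union> blob P Q M \<union> {H}"
proof -
  have *: "{..<Suc M} = {0..M}" "{0..M} = {0..<M} \<union> {M}"
    by auto
  have "(\<Union>i<Suc M. blob P Q i) = (\<Union>i\<in>{0..<M}. blob P Q i) \<union> blob P Q M"
    unfolding * by blast
  then show ?thesis
    unfolding necklace_def seg_def *(1) by blast
qed

lemma disjoint_beads:
  "H \<notin> seg P Q p q" "H \<notin> blob P Q i"
  "j < p \<or> q \<le> j \<Longrightarrow> seg P Q p q \<inter> blob P Q j = {}"
  "j < p \<or> q \<le> j \<Longrightarrow> blob P Q j \<inter> seg P Q p q = {}"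
  "q < p' \<Longrightarrow> seg P Q p q \<inter> seg P Q p' q' = {}"
  "i \<noteq> j \<Longrightarrow> blob P Q i \<inter> blob P Q j = {}"
  by (auto simp: seg_def blob_def split: if_splits)

section \<open>Order of the necklace, absence of a Hamiltonian cycle, number of edges\<close>

lemma finite_blob: "finite (blob P Q i)"
  by (simp add: blob_def)

lemma finite_necklace: "finite (necklace m P Q)"
  by (simp add: necklace_def finite_blob)

lemma card_blob: "Q i \<Longrightarrow> card (blob (\<lambda>_. True) Q i) = 5" "\<not> Q i \<Longrightarrow> card (blob (\<lambda>_. True) Q i) = 4"
  by (simp_all add: blob_def)

lemma card_necklace: "card (necklace m (\<lambda>_. True) Q) = 5 * m + 1 + card {i. i < m \<and> Q i}"
proof -
  let ?b = "blob (\<lambda>_. True) Q"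
  have "card (\<Union>i<m. ?b i) = (\<Sum>i<m. card (?b i))"
    by (intro card_UN_disjoint) (auto simp: finite_blob disjoint_beads)
  also have "\<dots> = (\<Sum>i<m. 4 + (if Q i then 1 else 0))"
    by (intro sum.cong) (auto simp: card_blob)
  also have "\<dots> = 4 * m + card {i. i < m \<and> Q i}"
    by (simp add: sum.distrib flip: sum.inter_filter)
  finally have "card (\<Union>i<m. ?b i) = 4 * m + card {i. i < m \<and> Q i}" .
  moreover have "T ` {..<m} \<inter> (\<Union>i<m. ?b i) = {}" "H \<notin> T ` {..<m} \<union> (\<Union>i<m. ?b i)"
    by (auto simp: blob_simps)
  moreover have "card (T ` {..<m}) = m"
    by (simp add: card_image inj_on_def)
  ultimately show ?thesis
    by (simp add: necklace_def finite_blob card_Un_disjoint)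
qed

text \<open>The links and the hub form an independent set of size \<open>m + 1\<close>, so each of
  them is the successor of a vertex whose successor leaves its blob. With only three external
  neighbours, a blob allows one such departure, so there are at most \<open>m\<close>.\<close>

lemma not_hamiltonian_necklace:
  assumes m: "m \<ge> 2"
  shows "\<not> hamiltonian_on (adj m) (necklace m P Q)"
proof
  let ?V = "necklace m P Q"
  assume "hamiltonian_on (adj m) ?V"
  then obtain \<sigma> where \<sigma>: "bij_betw \<sigma> ?V ?V" "\<And>v. v \<in> ?V \<Longrightarrow> adj m v (\<sigma> v)"
      "\<And>v. v \<in> ?V \<Longrightarrow> \<sigma> (\<sigma> v) \<noteq> v"
    unfolding hamiltonian_on_def by blast
  have \<sigma>V: "\<sigma> v \<in> ?V" if "v \<in> ?V" for v
    using \<sigma>(1) that by (auto simp: bij_betw_def)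
  have inj: "inj_on \<sigma> ?V" using \<sigma>(1) by (simp add: bij_betw_def)
  define W where "W = insert H (T ` {..<m})"
  have cardW: "card W = m + 1"
    by (auto simp: W_def card_insert_if card_image inj_on_def)
  define out where "out i = {v \<in> blob P Q i. \<sigma> v \<notin> blob P Q i}" for i
  define inn where "inn i = {v \<in> ?V. v \<notin> blob P Q i \<and> \<sigma> v \<in> blob P Q i}" for i
  have "card (out i) \<le> 1" if i: "i < m" for i
  proof -
    let ?b = "blob P Q i"
    have bV: "?b \<subseteq> ?V" using i by (auto simp: necklace_def)
    let ?ext = "{T i, T (Suc i mod m), H}"
    \<comment> \<open>Needed for each external vertex to have only one neighbour in the blob; for
      \<open>m = 1\<close> the link would meet both \<open>A i\<close> and
      \<open>B i\<close>.\<close>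
    have ne: "Suc i mod m \<noteq> i"
      using m i by (auto simp: mod_Suc)
    have port: "y \<in> ?ext \<and>
        (y = T i \<and> x = A i \<or> y = T (Suc i mod m) \<and> x = B i \<or> y = H \<and> x = C i)"
      if "x \<in> ?b" "y \<notin> ?b" "y \<in> ?V" "adj m x y" for x y
      using that by (cases y) (auto simp: blob_def adj_def necklace_simps split: if_splits)
    have oV: "out i \<subseteq> ?V" using bV by (auto simp: out_def)
    have o: "\<sigma> ` out i \<subseteq> ?ext"
      using port \<sigma>(2) \<sigma>V bV by (fastforce simp: out_def)
    have n: "inn i \<subseteq> ?ext"
      using port \<sigma>(2) \<sigma>V bV sympD[OF symp_adj] by (fastforce simp: inn_def)
    \<comment> \<open>An external vertex that is reached from the blob and leads back into it would
      return to the vertex it came from, and \<open>\<sigma>\<close> has no 2-cycles.\<close>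
    have disj: "\<sigma> ` out i \<inter> inn i = {}"
    proof (rule ccontr)
      assume "\<sigma> ` out i \<inter> inn i \<noteq> {}"
      then obtain v where v: "v \<in> ?b" "\<sigma> v \<notin> ?b" "\<sigma> (\<sigma> v) \<in> ?b"
        by (auto simp: out_def inn_def)
      have vV: "v \<in> ?V" using v bV by auto
      have 1: "adj m v (\<sigma> v)" "adj m (\<sigma> (\<sigma> v)) (\<sigma> v)" "\<sigma> v \<in> ?V"
        using \<sigma>(2) \<sigma>V vV sympD[OF symp_adj] by blast+
      have "v = \<sigma> (\<sigma> v)"
        using port[OF v(1,2) 1(3) 1(1)] port[OF v(3,2) 1(3) 1(2)] ne by auto
      then show False using \<sigma>(3)[OF vV] by simp
    qed
    \<comment> \<open>The blob and its preimage under \<open>\<sigma>\<close> have equal size;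
      discarding the vertices that stay inside leaves departures and arrivals. Hence twice the
      number of departures is at most 3.\<close>
    have "card (out i) = card (inn i)"
    proof -
      define both where "both = {v \<in> ?b. \<sigma> v \<in> ?b}"
      define pre where "pre = {v \<in> ?V. \<sigma> v \<in> ?b}"
      have "\<sigma> ` pre = ?b"
        using \<sigma>(1) bV by (force simp: pre_def bij_betw_def)
      moreover have "inj_on \<sigma> pre"
        by (rule inj_on_subset[OF inj]) (auto simp: pre_def)
      ultimately have "card pre = card ?b"
        by (metis card_image)
      moreover have "card pre = card both + card (inn i)"
        by (subst card_Un_disjoint[symmetric])
          (use bV finite_blob finite_necklace in \<open>auto simp: both_def inn_def pre_def intro!: arg_cong[of _ _ card]\<close>)
      moreover have "card ?b = card both + card (out i)"
        by (subst card_Un_disjoint[symmetric])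
          (use finite_blob in \<open>auto simp: both_def out_def intro!: arg_cong[of _ _ card]\<close>)
      ultimately show ?thesis by simp
    qed
    moreover have "card (\<sigma> ` out i) = card (out i)"
      by (rule card_image[OF inj_on_subset[OF inj oV]])
    moreover have "card (\<sigma> ` out i) + card (inn i) = card (\<sigma> ` out i \<union> inn i)"
      using disj o n by (subst card_Un_disjoint) (auto intro: finite_subset)
    moreover have "card (\<sigma> ` out i \<union> inn i) \<le> card ?ext"
      using o n by (intro card_mono) auto
    moreover have "card ?ext \<le> 3"
      by (simp add: card_insert_if)
    ultimately show ?thesis by linarith
  qed
  then have le: "(\<Sum>i<m. card (out i)) \<le> m"
    using sum_bounded_above[of "{..<m}" "\<lambda>i. card (out i)" 1] by simp
  have "W \<subseteq> \<sigma> ` (\<Union>i<m. out i)"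
  proof
    fix t assume t: "t \<in> W"
    then have "t \<in> ?V" by (auto simp: W_def necklace_simps)
    then obtain v where v: "v \<in> ?V" "t = \<sigma> v"
      using \<sigma>(1) by (auto simp: bij_betw_def)
    have "v \<notin> W"
      using \<sigma>(2)[OF v(1)] t v(2) by (auto simp: W_def adj_def)
    then obtain i where "i < m" "v \<in> blob P Q i"
      using v(1) by (auto simp: W_def necklace_def)
    moreover have "t \<notin> blob P Q i"
      using t by (auto simp: W_def blob_simps)
    ultimately show "t \<in> \<sigma> ` (\<Union>i<m. out i)"
      using v(2) by (auto simp: out_def)
  qed
  moreover have fin: "finite (\<Union>i<m. out i)"
    by (auto simp: out_def finite_blob)
  ultimately have "card W \<le> card (\<Union>i<m. out i)"
    by (meson card_image_le card_mono finite_imageI le_trans)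
  also have "\<dots> \<le> (\<Sum>i<m. card (out i))"
    by (rule card_UN_le) simp
  finally show False using le cardW by simp
qed

text \<open>A blob accounts for five inner edges and three edges to links and hub, and its extra
  vertex \<open>E i\<close> for three more.\<close>

lemma card_necklace_edges:
  "card {{x, y} | x y. x \<in> necklace m P Q \<and> y \<in> necklace m P Q \<and> adj m x y}
     \<le> 8 * m + 3 * card {i. i < m \<and> Q i}" (is "card ?S \<le> _")
proof -
  define q where "q = {i. i < m \<and> Q i}"
  define L where "L =
    [(\<lambda>i. {T i, A i}) ` {..<m}, (\<lambda>i. {B i, T (Suc i mod m)}) ` {..<m}, (\<lambda>i. {C i, H}) ` {..<m},
     (\<lambda>i. {A i, C i}) ` {..<m}, (\<lambda>i. {A i, D i}) ` {..<m}, (\<lambda>i. {B i, C i}) ` {..<m},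
     (\<lambda>i. {B i, D i}) ` {..<m}, (\<lambda>i. {C i, D i}) ` {..<m},
     (\<lambda>i. {A i, E i}) ` q, (\<lambda>i. {B i, E i}) ` q, (\<lambda>i. {D i, E i}) ` q]"
  have sub: "{x, y} \<in> \<Union> (set L)" if "x \<in> necklace m P Q" "y \<in> necklace m P Q" "arc m x y" for x y
    using that unfolding L_def q_def
    by (cases x; cases y) (auto simp: necklace_simps)
  have "?S \<subseteq> \<Union> (set L)"
    using sub by (auto simp: adj_def) (metis insert_commute)+
  moreover have finq: "finite q" by (simp add: q_def)
  then have "finite (\<Union> (set L))" by (auto simp: L_def)
  ultimately have "card ?S \<le> card (\<Union> (set L))"
    by (rule card_mono[rotated])
  also have "\<dots> \<le> sum_list (map card L)"
  proof (induction L)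
    case (Cons a L)
    then show ?case using card_Un_le[of a "\<Union> (set L)"] by simp
  qed simp
  also have "\<dots> \<le> 8 * m + 3 * card q"
  proof -
    have "card (f ` {..<m}) \<le> m" for f :: "nat \<Rightarrow> bead set"
      using card_image_le[of "{..<m}" f] by simp
    note a = this
    have b: "card (f ` q) \<le> card q" for f :: "nat \<Rightarrow> bead set"
      using card_image_le[OF finq] .
    have "sum_list (map card L) \<le> sum_list [m, m, m, m, m, m, m, m, card q, card q, card q]"
      unfolding L_def list.map sum_list.Cons by (intro add_mono a b) simp
    then show ?thesis by simp
  qed
  finally show ?thesis by (simp add: q_def)
qed

section \<open>Long paths in the necklace\<close>

text \<open>These are the two visits that a path pays to a blob that it enters twice.\<close>

definition left_split :: "nat \<Rightarrow> (nat \<Rightarrow> bool) \<Rightarrow> (nat \<Rightarrow> bool) \<Rightarrow> bead \<Rightarrow> nat \<Rightarrow> bool" where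
  "left_split m P Q x i \<longleftrightarrow> (\<exists>S S'. S \<union> S' = blob P Q i \<and> S \<inter> S' = {} \<and>
     path_on (adj m) S x (A i) \<and> path_on (adj m) S' (B i) (C i))"

definition right_split :: "nat \<Rightarrow> (nat \<Rightarrow> bool) \<Rightarrow> (nat \<Rightarrow> bool) \<Rightarrow> bead \<Rightarrow> nat \<Rightarrow> bool" where
  "right_split m P Q x i \<longleftrightarrow> (\<exists>S S'. S \<union> S' = blob P Q i \<and> S \<inter> S' = {} \<and>
     path_on (adj m) S x (B i) \<and> path_on (adj m) S' (A i) (C i))"

section \<open>Traversals of a single blob and of a stretch\<close>

context
  fixes M :: nat and P Q :: "nat \<Rightarrow> bool"
  assumes QP: "\<And>i. Q i \<Longrightarrow> P i"
begin

text \<open>Without \<open>D i\<close> the visit \<open>A i\<close>, \<open>C i\<close>,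
  \<open>B i\<close> still covers the blob, and this is where paths get shortened. If
  \<open>E i\<close> is present, \<open>D i\<close> has to link it to \<open>C i\<close>, hence the
  assumption \<open>QP\<close>.\<close>

lemma blob_A_B: "path_on (adj m) (blob P Q i) (A i) (B i)"
proof -
  consider "\<not> P i" "\<not> Q i" | "P i" "\<not> Q i" | "P i" "Q i" using QP by blast
  then show ?thesis
  proof cases
    case 1 then show ?thesis
      by (intro path_onI[of "[A i, C i, B i]"]) (auto simp: adj_def blob_def)
  next
    case 2 then show ?thesis
      by (intro path_onI[of "[A i, C i, D i, B i]"]) (auto simp: adj_def blob_def)
  next
    case 3 then show ?thesis
      by (intro path_onI[of "[A i, C i, D i, E i, B i]"]) (auto simp: adj_def blob_def)
  qed
qed

text \<open>Used to leave for the hub. Here \<open>D i\<close> is required: with \<open>D i\<close>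
  and \<open>E i\<close> absent, \<open>B i\<close> would be adjacent within the blob to
  \<open>C i\<close> only.\<close>

lemma blob_A_C: "P i \<Longrightarrow> path_on (adj m) (blob P Q i) (A i) (C i)"
  by (rule path_onI[of "if Q i then [A i, E i, D i, B i, C i] else [A i, D i, B i, C i]"])
    (auto simp: adj_def blob_def)

lemma blob_B_C: "P i \<Longrightarrow> path_on (adj m) (blob P Q i) (B i) (C i)"
  by (rule path_onI[of "if Q i then [B i, E i, D i, A i, C i] else [B i, D i, A i, C i]"])
    (auto simp: adj_def blob_def)

text \<open>Sets \<open>C i\<close> aside as an end of the path next to the hub, while the rest of
  the blob is still passed from \<open>A i\<close> to \<open>B i\<close>.\<close>

lemma blob_A_B_minus_C:
  assumes "P i"
  obtains S where "{C i} \<union> S = blob P Q i" "{C i} \<inter> S = {}" "path_on (adj m) S (A i) (B i)"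
proof
  show "path_on (adj m) (blob P Q i - {C i}) (A i) (B i)"
    by (rule path_onI[of "if Q i then [A i, D i, E i, B i] else [A i, D i, B i]"])
      (use assms in \<open>auto simp: adj_def blob_def\<close>)
qed (auto simp: blob_simps)

text \<open>For \<open>x = A i\<close> the beads \<open>D i\<close> and \<open>E i\<close> are
  absorbed by the second piece, for \<open>x = D i\<close> by the first, and for
  \<open>x = E i\<close> each piece takes one.\<close>

lemma left_splitI:
  assumes "P i" "x \<in> blob P Q i" "x \<noteq> B i" "x \<noteq> C i"
  shows "left_split m P Q x i"
proof -
  consider "x = A i" | "x = D i" | "x = E i" "Q i"
    using assms by (auto simp: blob_def split: if_splits)
  then show ?thesis
  proof cases
    case 1
    show ?thesis unfolding left_split_def 1
      by (rule exI[of _ "{A i}"], rule exI[of _ "blob P Q i - {A i}"], intro conjI path_on_single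
          path_onI[of "if Q i then [B i, E i, D i, C i] else [B i, D i, C i]"])
        (use assms(1) in \<open>auto simp: adj_def blob_def\<close>)
  next
    case 2
    show ?thesis unfolding left_split_def 2
      by (rule exI[of _ "blob P Q i - {B i, C i}"], rule exI[of _ "{B i, C i}"], intro conjI
          path_onI[of "if Q i then [D i, E i, A i] else [D i, A i]"] path_onI[of "[B i, C i]"])
        (use assms(1) in \<open>auto simp: adj_def blob_def\<close>)
  next
    case 3
    show ?thesis unfolding left_split_def 3(1)
      by (rule exI[of _ "{E i, A i}"], rule exI[of _ "{B i, D i, C i}"], intro conjI
          path_onI[of "[E i, A i]"] path_onI[of "[B i, D i, C i]"])
        (use assms(1) 3 in \<open>auto simp: adj_def blob_def\<close>)
  qed
qed

lemma right_splitI: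
  assumes "P i" "x \<in> blob P Q i" "x \<noteq> A i" "x \<noteq> C i"
  shows "right_split m P Q x i"
proof -
  consider "x = B i" | "x = D i" | "x = E i" "Q i"
    using assms by (auto simp: blob_def split: if_splits)
  then show ?thesis
  proof cases
    case 1
    show ?thesis unfolding right_split_def 1
      by (rule exI[of _ "{B i}"], rule exI[of _ "blob P Q i - {B i}"], intro conjI path_on_single
          path_onI[of "if Q i then [A i, E i, D i, C i] else [A i, D i, C i]"])
        (use assms(1) in \<open>auto simp: adj_def blob_def\<close>)
  next
    case 2
    show ?thesis unfolding right_split_def 2
      by (rule exI[of _ "blob P Q i - {A i, C i}"], rule exI[of _ "{A i, C i}"], intro conjI
          path_onI[of "if Q i then [D i, E i, B i] else [D i, B i]"] path_onI[of "[A i, C i]"])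
        (use assms(1) in \<open>auto simp: adj_def blob_def\<close>)
  next
    case 3
    show ?thesis unfolding right_split_def 3(1)
      by (rule exI[of _ "{E i, B i}"], rule exI[of _ "{A i, D i, C i}"], intro conjI
          path_onI[of "[E i, B i]"] path_onI[of "[A i, D i, C i]"])
        (use assms(1) 3 in \<open>auto simp: adj_def blob_def\<close>)
  qed
qed

lemma seg_path:
  assumes "p \<le> q" "q < m"
  shows "path_on (adj m) (seg P Q p q) (T p) (T q)"
  using assms
proof (induction q rule: dec_induct)
  case base
  then show ?case by (simp add: seg_def path_on_single)
next
  case (step q)
  have eq: "seg P Q p (Suc q) = seg P Q p q \<union> blob P Q q \<union> {T (Suc q)}"
    using step.hyps by (auto simp: seg_def atLeastAtMostSuc_conv atLeastLessThanSuc)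
  show ?case unfolding eq
    by (rule path_on_append[OF path_on_append[OF step.IH blob_A_B] path_on_single])
      (use step in \<open>auto simp: adj_def disjoint_beads seg_simps blob_simps\<close>)
qed

abbreviation (input) "R \<equiv> adj (Suc M)"

lemmas disjoint_simps = Int_Un_distrib Int_Un_distrib2 Int_commute

lemmas rev_path = path_on_rev[OF symp_adj]

lemma adj_simps:
  "adj m (T i) (A i)" "adj m (A i) (T i)" "R (B M) (T 0)" "R (T 0) (B M)"
  "i < M \<Longrightarrow> R (B i) (T (Suc i))" "i < M \<Longrightarrow> R (T (Suc i)) (B i)"
  "adj m (C i) H" "adj m H (C i)"
  by (auto simp: adj_def)

section \<open>Hamiltonian paths that single out the blobs \<open>j\<close> and
  \<open>M\<close>\<close>

context
  fixes j :: nat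
  assumes j: "j < M"
begin

lemma seg0: "path_on R (seg P Q 0 j) (T 0) (T j)"
  and seg1: "path_on R (seg P Q (Suc j) M) (T (Suc j)) (T M)"
  using j by (auto intro: seg_path)

lemma parts_disjoint:
  "seg P Q 0 j \<inter> blob P Q j = {}" "seg P Q 0 j \<inter> seg P Q (Suc j) M = {}" "seg P Q 0 j \<inter> blob P Q M = {}"
  "blob P Q j \<inter> seg P Q (Suc j) M = {}" "blob P Q j \<inter> blob P Q M = {}"
  "seg P Q (Suc j) M \<inter> blob P Q M = {}"
  "H \<notin> seg P Q 0 j" "H \<notin> seg P Q (Suc j) M" "H \<notin> blob P Q j" "H \<notin> blob P Q M"
  using j by (auto simp: disjoint_beads)

text \<open>Both blobs are visited twice: from \<open>x\<close> out at \<open>A M\<close>, backwards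
  to \<open>B j\<close>, through \<open>C j\<close>, the hub and \<open>C M\<close> to
  \<open>B M\<close>, then forwards from \<open>T 0\<close> into \<open>A j\<close> and on to
  \<open>y\<close>.\<close>

lemma ham_split_split:
  assumes "left_split (Suc M) P Q x M" "left_split (Suc M) P Q y j"
  shows "path_on R (necklace (Suc M) P Q) x y"
proof -
  obtain S S' where S: "S \<union> S' = blob P Q M" "S \<inter> S' = {}" "path_on R S x (A M)" "path_on R S' (B M) (C M)"
    using assms(1) unfolding left_split_def by blast
  obtain W W' where W: "W \<union> W' = blob P Q j" "W \<inter> W' = {}" "path_on R W y (A j)" "path_on R W' (B j) (C j)"
    using assms(2) unfolding left_split_def by blast
  have "path_on R (S \<union> seg P Q (Suc j) M \<union> W' \<union> {H} \<union> S' \<union> seg P Q 0 j \<union> W) x y"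
    by (rule path_on_append[OF path_on_append[OF path_on_append[OF path_on_append[OF path_on_append[OF
          path_on_append[OF S(3) rev_path[OF seg1]] W(4)] path_on_single] rev_path[OF S(4)]] seg0] rev_path[OF W(3)]])
      (use parts_disjoint[folded S(1) W(1)] S(2) W(2) j in \<open>simp_all add: disjoint_simps adj_simps\<close>)
  also have "S \<union> seg P Q (Suc j) M \<union> W' \<union> {H} \<union> S' \<union> seg P Q 0 j \<union> W = necklace (Suc M) P Q"
    unfolding necklace_split[OF j] S(1)[symmetric] W(1)[symmetric] by blast
  finally show ?thesis .
qed

text \<open>From \<open>C M\<close> the hub leads to \<open>C j\<close>; blob \<open>j\<close> is
  left at \<open>B j\<close>, the rest of the necklace is passed forwards, including blob
  \<open>M\<close> without \<open>C M\<close>, and blob \<open>j\<close> is entered again at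
  \<open>A j\<close>.\<close>

lemma ham_top_split:
  assumes "P M" "left_split (Suc M) P Q y j"
  shows "path_on R (necklace (Suc M) P Q) (C M) y"
proof -
  obtain W W' where W: "W \<union> W' = blob P Q j" "W \<inter> W' = {}" "path_on R W y (A j)" "path_on R W' (B j) (C j)"
    using assms(2) unfolding left_split_def by blast
  obtain S where S: "{C M} \<union> S = blob P Q M" "{C M} \<inter> S = {}" "path_on R S (A M) (B M)"
    using assms(1) by (rule blob_A_B_minus_C)
  have "path_on R ({C M} \<union> {H} \<union> W' \<union> seg P Q (Suc j) M \<union> S \<union> seg P Q 0 j \<union> W) (C M) y"
    by (rule path_on_append[OF path_on_append[OF path_on_append[OF path_on_append[OF path_on_append[OF
          path_on_append[OF path_on_single path_on_single] rev_path[OF W(4)]] seg1] S(3)] seg0] rev_path[OF W(3)]])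
      (use parts_disjoint[folded S(1) W(1)] S(2) W(2) j in \<open>simp_all add: disjoint_simps adj_simps\<close>)
  also have "{C M} \<union> {H} \<union> W' \<union> seg P Q (Suc j) M \<union> S \<union> seg P Q 0 j \<union> W = necklace (Suc M) P Q"
    unfolding necklace_split[OF j] S(1)[symmetric] W(1)[symmetric] by blast
  finally show ?thesis .
qed

text \<open>Forwards to blob \<open>j\<close>, over the hub to blob \<open>M\<close>, then backwards
  to the other side of blob \<open>j\<close>.\<close>

lemma ham_T_split:
  assumes "P M" "right_split (Suc M) P Q x j"
  shows "path_on R (necklace (Suc M) P Q) (T 0) x"
proof -
  obtain W W' where W: "W \<union> W' = blob P Q j" "W \<inter> W' = {}" "path_on R W x (B j)" "path_on R W' (A j) (C j)"
    using assms(2) unfolding right_split_def by blast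
  have "path_on R (seg P Q 0 j \<union> W' \<union> {H} \<union> blob P Q M \<union> seg P Q (Suc j) M \<union> W) (T 0) x"
    by (rule path_on_append[OF path_on_append[OF path_on_append[OF path_on_append[OF path_on_append[OF
          seg0 W(4)] path_on_single] rev_path[OF blob_A_C[OF assms(1)]]] rev_path[OF seg1]] rev_path[OF W(3)]])
      (use parts_disjoint[folded W(1)] W(2) j in \<open>simp_all add: disjoint_simps adj_simps\<close>)
  also have "seg P Q 0 j \<union> W' \<union> {H} \<union> blob P Q M \<union> seg P Q (Suc j) M \<union> W = necklace (Suc M) P Q"
    unfolding necklace_split[OF j] W(1)[symmetric] by blast
  finally show ?thesis .
qed

text \<open>The way round passes blob \<open>j\<close> without \<open>C j\<close>, which is reached
  last, from the hub.\<close>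

lemma ham_T_top:
  assumes "P j" "P M"
  shows "path_on R (necklace (Suc M) P Q) (T 0) (C j)"
proof -
  obtain S where S: "{C j} \<union> S = blob P Q j" "{C j} \<inter> S = {}" "path_on R S (A j) (B j)"
    using assms(1) by (rule blob_A_B_minus_C)
  have "path_on R (seg P Q 0 j \<union> S \<union> seg P Q (Suc j) M \<union> blob P Q M \<union> {H} \<union> {C j}) (T 0) (C j)"
    by (rule path_on_append[OF path_on_append[OF path_on_append[OF path_on_append[OF path_on_append[OF
          seg0 S(3)] seg1] blob_A_C[OF assms(2)]] path_on_single] path_on_single])
      (use parts_disjoint[folded S(1)] S(2) j in \<open>simp_all add: disjoint_simps adj_simps\<close>)
  also have "seg P Q 0 j \<union> S \<union> seg P Q (Suc j) M \<union> blob P Q M \<union> {H} \<union> {C j} = necklace (Suc M) P Q"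
    unfolding necklace_split[OF j] S(1)[symmetric] by blast
  finally show ?thesis .
qed

text \<open>The hub provides a jump from blob \<open>j\<close> to blob \<open>M\<close>, after which
  the second stretch is traversed backwards.\<close>

lemma ham_T_T:
  assumes "P j" "P M"
  shows "path_on R (necklace (Suc M) P Q) (T 0) (T (Suc j))"
proof -
  have "path_on R (seg P Q 0 j \<union> blob P Q j \<union> {H} \<union> blob P Q M \<union> seg P Q (Suc j) M) (T 0) (T (Suc j))"
    by (rule path_on_append[OF path_on_append[OF path_on_append[OF path_on_append[OF
          seg0 blob_A_C[OF assms(1)]] path_on_single] rev_path[OF blob_A_C[OF assms(2)]]] rev_path[OF seg1]])
      (use parts_disjoint j in \<open>simp_all add: disjoint_simps adj_simps\<close>)
  also have "seg P Q 0 j \<union> blob P Q j \<union> {H} \<union> blob P Q M \<union> seg P Q (Suc j) M = necklace (Suc M) P Q"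
    unfolding necklace_split[OF j] by blast
  finally show ?thesis .
qed

end

section \<open>Paths around the necklace, some of them omitting the hub or a link\<close>

lemma seg_all: "path_on R (seg P Q 0 M) (T 0) (T M)"
  by (simp add: seg_path)

lemma parts_last:
  "seg P Q 0 M \<inter> blob P Q M = {}" "H \<notin> seg P Q 0 M" "H \<notin> blob P Q M"
  by (auto simp: disjoint_beads)

lemma ham_T_H:
  assumes "P M"
  shows "path_on R (necklace (Suc M) P Q) (T 0) H"
  unfolding necklace_split_last
  by (rule path_on_append[OF path_on_append[OF seg_all blob_A_C[OF assms]] path_on_single])
    (use parts_last in \<open>simp_all add: disjoint_simps adj_simps\<close>)

text \<open>These ends are adjacent, so a Hamiltonian path between them would close to a Hamiltonian
  cycle; the hub is the vertex left out.\<close>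

lemma path_T_B: "path_on R (necklace (Suc M) P Q - {H}) (T 0) (B M)"
proof -
  have "path_on R (seg P Q 0 M \<union> blob P Q M) (T 0) (B M)"
    by (rule path_on_append[OF seg_all blob_A_B]) (use parts_last in \<open>simp_all add: disjoint_simps adj_simps\<close>)
  also have "seg P Q 0 M \<union> blob P Q M = necklace (Suc M) P Q - {H}"
    unfolding necklace_split_last using parts_last by blast
  finally show ?thesis .
qed

lemma path_top_split:
  assumes "left_split (Suc M) P Q x M"
  shows "path_on R (necklace (Suc M) P Q - {H}) (C M) x"
proof -
  obtain S S' where S: "S \<union> S' = blob P Q M" "S \<inter> S' = {}" "path_on R S x (A M)" "path_on R S' (B M) (C M)"
    using assms unfolding left_split_def by blast
  have "path_on R (S' \<union> seg P Q 0 M \<union> S) (C M) x"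
    by (rule path_on_append[OF path_on_append[OF rev_path[OF S(4)] seg_all] rev_path[OF S(3)]])
      (use parts_last[folded S(1)] S(2) in \<open>simp_all add: disjoint_simps adj_simps\<close>)
  also have "S' \<union> seg P Q 0 M \<union> S = necklace (Suc M) P Q - {H}"
    unfolding necklace_split_last using parts_last S(1) by blast
  finally show ?thesis .
qed

lemma ham_H_split:
  assumes "left_split (Suc M) P Q x M"
  shows "path_on R (necklace (Suc M) P Q) H x"
proof -
  have "path_on R ({H} \<union> (necklace (Suc M) P Q - {H})) H x"
    by (rule path_on_append[OF path_on_single path_top_split[OF assms]]) (auto intro: adj_simps)
  then show ?thesis
    by (simp add: insert_absorb necklace_simps)
qed

text \<open>Blob \<open>M\<close> is left at \<open>B M\<close>, the walk goes round up to blob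
  \<open>M - 1\<close>, and from there the hub leads to \<open>C j\<close>, so only
  \<open>T M\<close> is missed. Blob \<open>M - 1\<close> must not be blob \<open>j\<close>, hence
  \<open>Suc j < M\<close>.\<close>

lemma path_top_top:
  assumes "Suc j < M" "P j" "P (M - 1)" "P M"
  shows "path_on R (necklace (Suc M) P Q - {T M}) (C M) (C j)"
proof -
  obtain K where K: "M = Suc K" "j < K" using assms(1) by (cases M) auto
  obtain S where S: "{C j} \<union> S = blob P Q j" "{C j} \<inter> S = {}" "path_on R S (A j) (B j)"
    using assms(2) by (rule blob_A_B_minus_C)
  have split: "necklace (Suc M) P Q - {T M} =
      blob P Q M \<union> seg P Q 0 j \<union> S \<union> seg P Q (Suc j) K \<union> blob P Q K \<union> {H} \<union> {C j}"
  proof -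
    have "necklace (Suc M) P Q = necklace M P Q \<union> blob P Q M \<union> {T M}"
      by (auto simp: necklace_def lessThan_Suc)
    moreover have "T M \<notin> necklace M P Q \<union> blob P Q M"
      by (simp add: necklace_simps blob_simps)
    ultimately have "necklace (Suc M) P Q - {T M} = necklace M P Q \<union> blob P Q M"
      by blast
    then show ?thesis
      unfolding K(1) necklace_split[OF K(2)] S(1)[symmetric] by blast
  qed
  have adjs: "R (T K) (A K)" "R (T j) (A j)" "R (B j) (T (Suc j))" "R (B M) (T 0)" "R (C K) H" "R H (C j)"
    using K by (auto simp: adj_def)
  have s: "path_on R (seg P Q 0 j) (T 0) (T j)" "path_on R (seg P Q (Suc j) K) (T (Suc j)) (T K)"
    using K by (auto intro: seg_path)
  have d: "blob P Q M \<inter> seg P Q 0 j = {}" "blob P Q M \<inter> blob P Q j = {}" "blob P Q M \<inter> blob P Q K = {}"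
      "blob P Q M \<inter> seg P Q (Suc j) K = {}" "seg P Q 0 j \<inter> blob P Q j = {}" "seg P Q 0 j \<inter> seg P Q (Suc j) K = {}"
      "seg P Q 0 j \<inter> blob P Q K = {}" "blob P Q j \<inter> seg P Q (Suc j) K = {}" "blob P Q j \<inter> blob P Q K = {}"
      "seg P Q (Suc j) K \<inter> blob P Q K = {}" "H \<notin> seg P Q 0 j" "H \<notin> seg P Q (Suc j) K" "H \<notin> blob P Q j"
      "H \<notin> blob P Q K" "H \<notin> blob P Q M"
    using K by (auto simp: disjoint_beads)
  have PK: "P K" using assms(3) K by simp
  show ?thesis unfolding split
    by (rule path_on_append[OF path_on_append[OF path_on_append[OF path_on_append[OF path_on_append[OF path_on_append[OF
          rev_path[OF blob_B_C[OF assms(4)]] s(1)] S(3)] s(2)] blob_A_C[OF PK]]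
          path_on_single] path_on_single])
      (use d[folded S(1)] S(2) adjs in \<open>simp_all add: disjoint_simps\<close>)
qed

end

section \<open>Rotations and the reflection\<close>

abbreviation full :: "nat \<Rightarrow> (nat \<Rightarrow> bool) \<Rightarrow> bead set" where
  "full m Q \<equiv> necklace m (\<lambda>_. True) Q"

definition short_by :: "nat \<Rightarrow> nat \<Rightarrow> (nat \<Rightarrow> bool) \<Rightarrow> bead \<Rightarrow> bead \<Rightarrow> bool" where
  "short_by q m Q u v \<longleftrightarrow> long_path (adj m) (full m Q) (card (full m Q) - q) u v"

lemma short_by_rev: "short_by q m Q u v \<Longrightarrow> short_by q m Q v u"
  unfolding short_by_def by (rule long_path_rev[OF symp_adj])

lemma short_by_1I: "v \<in> full m Q \<Longrightarrow> path_on (adj m) (full m Q - {v}) x y \<Longrightarrow> short_by 1 m Q x y"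
  unfolding short_by_def long_path_def
  by (rule exI[of _ "full m Q - {v}"]) (simp add: finite_necklace)

text \<open>The premise \<open>path\<close> covers every admissible \<open>P\<close>, so it still
  applies after deleting \<open>q\<close> of the beads \<open>D i\<close>, taken from blobs without
  \<open>E i\<close> other than \<open>j\<close> and \<open>M\<close>.\<close>

lemma short_by_drop:
  assumes path: "\<And>P. (\<And>i. Q i \<Longrightarrow> P i) \<Longrightarrow> P j \<Longrightarrow> P M \<Longrightarrow> path_on (adj m) (necklace m P Q) u v"
    and m: "m \<ge> 8" and Q: "card {i. i < m \<and> Q i} \<le> 4" and q: "q \<le> 2"
  shows "short_by q m Q u v"
proof -
  define F where "F = {..<m} - {i. i < m \<and> Q i} - {j, M}"
  have "card {j, M} \<le> 2" by (simp add: card_insert_if)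
  moreover have "card {..<m} - card {i. i < m \<and> Q i} \<le> card ({..<m} - {i. i < m \<and> Q i})"
    by (rule diff_card_le_card_Diff) simp
  moreover have "card ({..<m} - {i. i < m \<and> Q i}) - card {j, M} \<le> card F"
    unfolding F_def by (rule diff_card_le_card_Diff) simp
  \<comment> \<open>At most 4 + 2 blobs are ruled out, so \<open>m \<ge> 8\<close> leaves
    two.\<close>
  ultimately have "q \<le> card F" using m Q q by simp
  then obtain Z where Z: "Z \<subseteq> F" "card Z = q" "finite Z"
    by (meson obtain_subset_with_card_n)
  let ?S = "necklace m (\<lambda>i. i \<notin> Z) Q"
  have "\<not> Q i" "i < m" if "i \<in> Z" for i
    using Z(1) that by (auto simp: F_def)
  then have "path_on (adj m) ?S u v"
    using Z(1) by (intro path) (auto simp: F_def)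
  moreover have S: "?S = full m Q - D ` Z"
    by (rule bead_set_eqI) (auto simp: necklace_simps)
  moreover have "D ` Z \<subseteq> full m Q"
    using Z(1) by (auto simp: F_def necklace_simps)
  then have "card ?S = card (full m Q) - q"
    unfolding S using Z by (subst card_Diff_subset) (auto simp: card_image inj_on_def)
  ultimately show ?thesis
    unfolding short_by_def long_path_def by (intro exI[of _ ?S]) auto
qed

fun rotate_bead :: "nat \<Rightarrow> nat \<Rightarrow> bead \<Rightarrow> bead" where
  "rotate_bead m s (T i) = T ((i + s) mod m)"
| "rotate_bead m s (A i) = A ((i + s) mod m)"
| "rotate_bead m s (B i) = B ((i + s) mod m)"
| "rotate_bead m s (C i) = C ((i + s) mod m)"
| "rotate_bead m s (D i) = D ((i + s) mod m)"
| "rotate_bead m s (E i) = E ((i + s) mod m)"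
| "rotate_bead m s H = H"

text \<open>The link \<open>T i\<close> precedes blob \<open>i\<close>, so after the reversal it
  follows blob \<open>m - 1 - i\<close> and gets the number \<open>m - i\<close>, with
  \<open>T 0\<close> fixed. The two ends \<open>A\<close> and \<open>B\<close> of a blob are
  exchanged.\<close>

fun mirror_bead :: "nat \<Rightarrow> bead \<Rightarrow> bead" where
  "mirror_bead m (T i) = T ((m - i) mod m)"
| "mirror_bead m (A i) = B (m - 1 - i)"
| "mirror_bead m (B i) = A (m - 1 - i)"
| "mirror_bead m (C i) = C (m - 1 - i)"
| "mirror_bead m (D i) = D (m - 1 - i)"
| "mirror_bead m (E i) = E (m - 1 - i)"
| "mirror_bead m H = H"

lemma short_by_map:
  assumes "short_by q m Q' u v" "inj_on f (full m Q')" "f ` full m Q' = full m Q"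
    and "\<And>x y. x \<in> full m Q' \<Longrightarrow> y \<in> full m Q' \<Longrightarrow> arc m x y \<Longrightarrow> adj m (f x) (f y)"
  shows "short_by q m Q (f u) (f v)"
proof -
  have card: "card (full m Q) = card (full m Q')"
    using assms(2,3) card_image by metis
  obtain S where S: "S \<subseteq> full m Q'" "card S = card (full m Q') - q" "path_on (adj m) S u v"
    using assms(1) unfolding short_by_def long_path_def by blast
  have inj: "inj_on f S" using assms(2) S(1) inj_on_subset by blast
  have "adj m (f x) (f y)" if "x \<in> S" "y \<in> S" "adj m x y" for x y
    using that S(1) assms(4) sympD[OF symp_adj] unfolding adj_def[of m x y] by blast
  then have "path_on (adj m) (f ` S) (f u) (f v)"
    using path_on_image[OF S(3) inj] by blast
  then show ?thesis
    unfolding short_by_def long_path_def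
    using S(1,2) assms(3) card card_image[OF inj] by (intro exI[of _ "f ` S"]) auto
qed

lemma rotate_index_bij: "m > 0 \<Longrightarrow> bij_betw (\<lambda>i. (i + s) mod m) {..<m} {..<m}" for m s :: nat
proof (induction s)
  case 0
  have "bij_betw (\<lambda>i. (i + 0) mod m) {..<m} {..<m} \<longleftrightarrow> bij_betw id {..<m} {..<m}"
    by (rule bij_betw_cong) simp
  then show ?case by simp
next
  case (Suc s)
  have "(\<lambda>i. (i + Suc s) mod m) = (\<lambda>i. Suc i mod m) \<circ> (\<lambda>i. (i + s) mod m)"
    by (simp add: fun_eq_iff mod_Suc_eq)
  then show ?case
    using bij_betw_trans[OF Suc.IH Suc_mod_bij] Suc.prems by simp
qed

lemma rotate_index_inj: fixes m :: nat shows "i < m \<Longrightarrow> j < m \<Longrightarrow> (i + s) mod m = (j + s) mod m \<longleftrightarrow> i = j"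
  using rotate_index_bij[of m s] inj_on_eq_iff[of "\<lambda>i. (i + s) mod m" "{..<m}" i j]
  by (simp add: bij_betw_def)

lemma rotate_index_surj:
  fixes j m :: nat
  assumes "j < m" obtains i where "i < m" "j = (i + s) mod m"
proof -
  have "j \<in> (\<lambda>i. (i + s) mod m) ` {..<m}"
    using rotate_index_bij[of m s] assms by (simp add: bij_betw_def)
  then show thesis using that by auto
qed

lemma rotate_full:
  assumes "m > 0"
  shows "rotate_bead m s ` full m (\<lambda>i. Q ((i + s) mod m)) = full m Q" (is "rotate_bead m s ` ?V = _")
proof (intro equalityI subsetI)
  fix y assume "y \<in> rotate_bead m s ` ?V"
  then obtain x where "x \<in> ?V" "y = rotate_bead m s x" by blast
  then show "y \<in> full m Q"
    using assms by (cases x) (auto simp: necklace_simps)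
next
  fix y assume y: "y \<in> full m Q"
  have "\<exists>x. x \<in> ?V \<and> y = rotate_bead m s x"
  proof (cases "y = H")
    case True
    then show ?thesis by (intro exI[of _ H]) (simp add: necklace_simps)
  next
    case False
    obtain i where "i < m" "case y of T j \<Rightarrow> j = (i + s) mod m | A j \<Rightarrow> j = (i + s) mod m | B j \<Rightarrow> j = (i + s) mod m
        | C j \<Rightarrow> j = (i + s) mod m | D j \<Rightarrow> j = (i + s) mod m | E j \<Rightarrow> j = (i + s) mod m | H \<Rightarrow> True"
      using y rotate_index_surj[of _ m s] assms by (cases y) (auto simp: necklace_simps)
    then show ?thesis
      using y False
      by (intro exI[of _ "case y of T j \<Rightarrow> T i | A j \<Rightarrow> A i | B j \<Rightarrow> B i | C j \<Rightarrow> C i | D j \<Rightarrow> D i | E j \<Rightarrow> E i"])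
        (cases y; simp add: necklace_simps)
  qed
  then show "y \<in> rotate_bead m s ` ?V" by blast
qed

text \<open>The pattern \<open>Q\<close> need not be invariant, so it is pulled back along the
  rotation. This is why paths are constructed for arbitrary sparse patterns.\<close>

lemma short_by_rotate:
  assumes "short_by q m (\<lambda>i. Q ((i + s) mod m)) u v" "m > 0"
  shows "short_by q m Q (rotate_bead m s u) (rotate_bead m s v)"
proof (rule short_by_map[OF assms(1)])
  let ?V = "full m (\<lambda>i. Q ((i + s) mod m))"
  show "inj_on (rotate_bead m s) ?V"
  proof (rule inj_onI)
    fix x y assume "x \<in> ?V" "y \<in> ?V" "rotate_bead m s x = rotate_bead m s y"
    then show "x = y"
      by (cases x; cases y) (auto simp: necklace_simps rotate_index_inj)
  qed
  show "rotate_bead m s ` ?V = full m Q"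
    using assms(2) by (rule rotate_full)
  fix x y assume "arc m x y"
  then show "adj m (rotate_bead m s x) (rotate_bead m s y)"
    by (cases x; cases y) (auto simp: adj_def mod_Suc_eq mod_add_left_eq)
qed

lemma short_by_mirror:
  assumes "short_by q m (\<lambda>i. Q (m - 1 - i)) u v"
  shows "short_by q m Q (mirror_bead m u) (mirror_bead m v)"
proof (rule short_by_map[OF assms])
  let ?V = "full m (\<lambda>i. Q (m - 1 - i))"
  have T: "(m - (m - i) mod m) mod m = i" if "i < m" for i
    using that by (cases "i = 0") auto
  have link: "(m - Suc i mod m) mod m = m - Suc i" "Suc (m - Suc i) mod m = (m - i) mod m" if "i < m" for i
  proof -
    show "(m - Suc i mod m) mod m = m - Suc i"
      using that by (cases "Suc i = m") auto
    show "Suc (m - Suc i) mod m = (m - i) mod m"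
      using that by (simp add: Suc_diff_Suc)
  qed
  have inv: "mirror_bead m (mirror_bead m x) = x" if "x \<in> full m Q'" for x Q'
    using that by (cases x) (auto simp: necklace_simps T)
  show "inj_on (mirror_bead m) ?V"
    by (rule inj_on_inverseI[of _ "mirror_bead m"]) (rule inv)
  have into: "mirror_bead m x \<in> full m Q" if "x \<in> ?V" for x
    using that by (cases x) (auto simp: necklace_simps)
  have into': "mirror_bead m x \<in> ?V" if "x \<in> full m Q" for x
    using that by (cases x) (auto simp: necklace_simps)
  show "mirror_bead m ` ?V = full m Q"
  proof (intro equalityI subsetI)
    fix y assume y: "y \<in> full m Q"
    show "y \<in> mirror_bead m ` ?V"
      using inv[OF y] into'[OF y] by (metis imageI)
  qed (use into in blast)
  fix x y assume "arc m x y" "x \<in> ?V" "y \<in> ?V"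
  then show "adj m (mirror_bead m x) (mirror_bead m y)"
    using link by (cases x; cases y) (auto simp: adj_def necklace_simps)
qed

lemma card_rotated:
  fixes m :: nat
  assumes "m > 0"
  shows "card {i. i < m \<and> Q ((i + s) mod m)} = card {i. i < m \<and> Q i}"
proof -
  have "(\<lambda>i. (i + s) mod m) ` {i. i < m \<and> Q ((i + s) mod m)} = {i. i < m \<and> Q i}"
  proof (intro equalityI subsetI)
    fix j assume j: "j \<in> {i. i < m \<and> Q i}"
    then obtain i where "i < m" "j = (i + s) mod m"
      using rotate_index_surj[of j m s] by blast
    then show "j \<in> (\<lambda>i. (i + s) mod m) ` {i. i < m \<and> Q ((i + s) mod m)}"
      using j by blast
  qed (use assms in auto)
  moreover have "inj_on (\<lambda>i. (i + s) mod m) {i. i < m \<and> Q ((i + s) mod m)}"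
    by (rule inj_onI) (simp add: rotate_index_inj)
  ultimately show ?thesis
    using card_image by fastforce
qed

lemma card_mirrored: fixes m :: nat shows "card {i. i < m \<and> Q (m - 1 - i)} = card {i. i < m \<and> Q i}"
  by (rule bij_betw_same_card[of "\<lambda>i. m - 1 - i"], rule bij_betw_byWitness[of _ "\<lambda>i. m - 1 - i"]) auto

section \<open>Saturation of the necklace\<close>

definition left_beads :: "(nat \<Rightarrow> bool) \<Rightarrow> nat \<Rightarrow> bead set" where
  "left_beads Q i = {A i, D i} \<union> (if Q i then {E i} else {})"

definition right_beads :: "(nat \<Rightarrow> bool) \<Rightarrow> nat \<Rightarrow> bead set" where
  "right_beads Q i = {B i, D i} \<union> (if Q i then {E i} else {})"

lemma left_beads_split: "(\<And>i. Q i \<Longrightarrow> P i) \<Longrightarrow> P i \<Longrightarrow> x \<in> left_beads Q i \<Longrightarrow> left_split m P Q x i"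
  by (rule left_splitI) (auto simp: left_beads_def blob_def split: if_splits)

lemma right_beads_split: "(\<And>i. Q i \<Longrightarrow> P i) \<Longrightarrow> P i \<Longrightarrow> x \<in> right_beads Q i \<Longrightarrow> right_split m P Q x i"
  by (rule right_splitI) (auto simp: right_beads_def blob_def split: if_splits)

lemma rotate_left_beads:
  "rotate_bead m s ` left_beads (\<lambda>i. Q ((i + s) mod m)) i = left_beads Q ((i + s) mod m)"
  by (auto simp: left_beads_def)

lemma mirror_left_beads:
  "i < m \<Longrightarrow> mirror_bead m ` left_beads (\<lambda>i. Q (m - 1 - i)) (m - 1 - i) = right_beads Q i"
  by (auto simp: left_beads_def right_beads_def)

text \<open>The number 4 is the largest remainder modulo 5. Unlike the pattern itself, this bound is
  preserved by rotations and the reflection.\<close>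

definition sparse :: "nat \<Rightarrow> (nat \<Rightarrow> bool) \<Rightarrow> bool" where
  "sparse m Q \<longleftrightarrow> card {i. i < m \<and> Q i} \<le> 4"

lemma sparse_rotated: "sparse m Q \<Longrightarrow> m > 0 \<Longrightarrow> sparse m (\<lambda>i. Q ((i + s) mod m))"
  by (simp add: sparse_def card_rotated)

lemma sparse_mirrored: "sparse m Q \<Longrightarrow> sparse m (\<lambda>i. Q (m - 1 - i))"
  unfolding sparse_def card_mirrored .

context
  fixes m M :: nat
  assumes m: "m = Suc M" "m \<ge> 8"
begin

section \<open>Paths from a link\<close>

lemma short_by_dropI:
  assumes "\<And>P. (\<And>i. Q i \<Longrightarrow> P i) \<Longrightarrow> P j \<Longrightarrow> P M \<Longrightarrow> path_on (adj m) (necklace m P Q) u v"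
    and "sparse m Q" "q \<le> 2"
  shows "short_by q m Q u v"
  using short_by_drop[of Q j M m u v q] assms m(2) unfolding sparse_def by blast

lemma short_by_T0_half:
  assumes "sparse m Q" "q \<le> 2" "j < M" "x \<in> right_beads Q j \<or> x = C j"
  shows "short_by q m Q (T 0) x"
  by (rule short_by_dropI[of Q j]) (use assms m in \<open>auto intro!: ham_T_split ham_T_top right_beads_split\<close>)

text \<open>The direct constructions reach \<open>C\<close> and the right beads of all blobs but the
  last. The reflection fixes \<open>T 0\<close> and exchanges blob \<open>M\<close> with blob 0,
  which supplies the beads \<open>A i\<close> and the last blob. The excluded \<open>A 0\<close> and
  \<open>B M\<close> are the neighbours of \<open>T 0\<close>.\<close>

lemma short_by_T0:
  assumes Q: "sparse m Q" and q: "q \<le> 2" and x: "x \<in> full m Q" "x \<noteq> T 0" "x \<noteq> A 0" "x \<noteq> B M"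
  shows "short_by q m Q (T 0) x"
proof -
  let ?Q = "\<lambda>i. Q (m - 1 - i)"
  have mir: "short_by q m Q (T 0) x" if "i \<le> M" "i \<noteq> 0" "x = mirror_bead m y"
    "y \<in> right_beads ?Q (M - i) \<or> y = C (M - i)" for y i
    using short_by_mirror[OF short_by_T0_half[OF sparse_mirrored[OF Q] q _ that(4)]] that m by simp
  show ?thesis
  proof (cases x)
    case (T i)
    then obtain j where j: "i = Suc j" "j < M"
      using x m by (cases i) (auto simp: necklace_simps)
    show ?thesis unfolding T j(1)
      by (rule short_by_dropI[of Q j]) (use Q q m j in \<open>auto intro!: ham_T_T\<close>)
  next
    case (A i)
    then show ?thesis
      using x m by (intro mir[of i "B (M - i)"]) (auto simp: necklace_simps right_beads_def)
  next
    case (B i)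
    then show ?thesis
      using x m by (intro short_by_T0_half[OF Q q, of i]) (auto simp: necklace_simps right_beads_def)
  next
    case (C i)
    show ?thesis
    proof (cases "i < M")
      case True
      then show ?thesis using C by (intro short_by_T0_half[OF Q q, of i]) auto
    next
      case False
      then show ?thesis
        using x m C by (intro mir[of M "C 0"]) (auto simp: necklace_simps)
    qed
  next
    case (D i)
    show ?thesis
    proof (cases "i < M")
      case True
      then show ?thesis using D by (intro short_by_T0_half[OF Q q, of i]) (auto simp: right_beads_def)
    next
      case False
      then show ?thesis
        using x m D by (intro mir[of M "D 0"]) (auto simp: necklace_simps right_beads_def)
    qed
  next
    case (E i)
    show ?thesis
    proof (cases "i < M")
      case True
      then show ?thesis using E x by (intro short_by_T0_half[OF Q q, of i]) (auto simp: right_beads_def necklace_simps)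
    next
      case False
      then have "i = M" using x E m by (auto simp: necklace_simps)
      then show ?thesis
        using x m E by (intro mir[of M "E 0"]) (auto simp: necklace_simps right_beads_def)
    qed
  next
    case H
    show ?thesis unfolding H
      by (rule short_by_dropI[of Q M]) (use Q q m in \<open>auto intro!: ham_T_H\<close>)
  qed
qed

text \<open>Going round without the hub gives \<open>q = 1\<close>. This suffices, since adjacent
  ends arise only when the added edge joins a leaf to a core vertex.\<close>

lemma short_by_T0_adjacent: "short_by 1 m Q (T 0) (B M)" "short_by 1 m Q (T 0) (A 0)"
proof -
  have *: "short_by 1 m Q (T 0) (B M)" for Q
    by (rule short_by_1I[of H]) (simp add: necklace_simps, simp add: m path_T_B)
  then show "short_by 1 m Q (T 0) (B M)" .
  show "short_by 1 m Q (T 0) (A 0)"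
    using short_by_mirror[OF *] m by simp
qed

lemma rotate_to_T0:
  assumes p: "p < m" and x: "x \<in> full m Q" "x \<noteq> T p"
  obtains x' where "x = rotate_bead m p x'" "x' \<in> full m (\<lambda>i. Q ((i + p) mod m))" "x' \<noteq> T 0"
    "\<not> adj m (T p) x \<Longrightarrow> x' \<noteq> A 0 \<and> x' \<noteq> B M"
proof -
  have "x \<in> rotate_bead m p ` full m (\<lambda>i. Q ((i + p) mod m))"
    using x(1) m by (subst rotate_full) auto
  then obtain x' where x': "x = rotate_bead m p x'" "x' \<in> full m (\<lambda>i. Q ((i + p) mod m))" by blast
  moreover have "x' \<noteq> T 0" using x' x p by auto
  moreover have "p = Suc ((M + p) mod m) mod m"
    using m p by (simp add: mod_Suc_eq flip: add_Suc)
  then have "adj m (T p) x" if "x' = A 0 \<or> x' = B M"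
    using that x'(1) p by (auto simp: adj_def)
  ultimately show thesis using that by blast
qed

lemma short_by_T_nonadjacent:
  assumes "sparse m Q" "q \<le> 2" "p < m" "x \<in> full m Q" "x \<noteq> T p" "\<not> adj m (T p) x"
  shows "short_by q m Q (T p) x"
proof -
  obtain x' where x': "x = rotate_bead m p x'" "x' \<in> full m (\<lambda>i. Q ((i + p) mod m))" "x' \<noteq> T 0"
    "x' \<noteq> A 0" "x' \<noteq> B M"
    using rotate_to_T0[OF assms(3-5)] assms(6) by metis
  have "short_by q m Q (rotate_bead m p (T 0)) (rotate_bead m p x')"
    by (intro short_by_rotate short_by_T0 sparse_rotated) (use assms m x' in auto)
  then show ?thesis using x' assms(3) by simp
qed

lemma short_by_T:
  assumes "sparse m Q" "p < m" "x \<in> full m Q" "x \<noteq> T p"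
  shows "short_by 1 m Q (T p) x"
proof -
  obtain x' where x': "x = rotate_bead m p x'" "x' \<in> full m (\<lambda>i. Q ((i + p) mod m))" "x' \<noteq> T 0"
    using rotate_to_T0[OF assms(2-4)] by metis
  have "short_by 1 m (\<lambda>i. Q ((i + p) mod m)) (T 0) x'"
    using short_by_T0[of _ 1 x'] short_by_T0_adjacent sparse_rotated[OF assms(1)] x' m by fastforce
  then have "short_by 1 m Q (rotate_bead m p (T 0)) (rotate_bead m p x')"
    using m by (intro short_by_rotate) auto
  then show ?thesis using x' assms(2) by simp
qed

section \<open>Paths from a blob or from the hub\<close>

lemma short_by_last_blob:
  assumes Q: "sparse m Q"
  shows "j < M \<Longrightarrow> x \<in> left_beads Q M \<Longrightarrow> y \<in> left_beads Q j \<Longrightarrow> short_by 0 m Q x y"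
    and "q \<le> 2 \<Longrightarrow> j < M \<Longrightarrow> y \<in> left_beads Q j \<Longrightarrow> short_by q m Q (C M) y"
    and "x \<in> left_beads Q M \<Longrightarrow> short_by 0 m Q H x"
    and "x \<in> left_beads Q M \<Longrightarrow> short_by 1 m Q (C M) x"
    and "Suc j < M \<Longrightarrow> short_by 1 m Q (C M) (C j)"
proof -
  show "short_by 0 m Q x y" if "j < M" "x \<in> left_beads Q M" "y \<in> left_beads Q j"
    by (rule short_by_dropI[of Q j]) (use Q m that in \<open>auto intro!: ham_split_split left_beads_split\<close>)
  show "short_by q m Q (C M) y" if "q \<le> 2" "j < M" "y \<in> left_beads Q j"
    by (rule short_by_dropI[of Q j]) (use Q m that in \<open>auto intro!: ham_top_split left_beads_split\<close>)
  show "short_by 0 m Q H x" if "x \<in> left_beads Q M"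
    by (rule short_by_dropI[of Q M]) (use Q m that in \<open>auto intro!: ham_H_split left_beads_split\<close>)
  show "short_by 1 m Q (C M) x" if "x \<in> left_beads Q M"
    by (rule short_by_1I[of H])
      (simp add: necklace_simps, use m that in \<open>auto intro!: path_top_split left_beads_split\<close>)
  show "short_by 1 m Q (C M) (C j)" if "Suc j < M"
    by (rule short_by_1I[of "T M"])
      (simp add: necklace_simps m, use m that in \<open>auto intro!: path_top_top\<close>)
qed

lemma rotate_index_last:
  assumes "i < m"
  shows "(M + Suc i) mod m = i"
proof -
  have "M + Suc i = i + m" using m by simp
  then show ?thesis using assms by (metis mod_add_self2 mod_less)
qed

lemma rotate_index_other:
  assumes "i < m" "j < m" "i \<noteq> j"
  obtains j' where "j' < M" "j = (j' + Suc i) mod m"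
proof -
  obtain j' where j': "j' < m" "j = (j' + Suc i) mod m"
    using rotate_index_surj[OF assms(2)] by blast
  then have "j' \<noteq> M" using assms rotate_index_last by metis
  then have "j' < M" using j'(1) m by simp
  then show thesis using that j'(2) by blast
qed

lemma short_by_blob:
  assumes Q: "sparse m Q" and i: "i < m"
  shows "j < m \<Longrightarrow> i \<noteq> j \<Longrightarrow> x \<in> left_beads Q i \<Longrightarrow> y \<in> left_beads Q j \<Longrightarrow> short_by 0 m Q x y"
    and "q \<le> 2 \<Longrightarrow> j < m \<Longrightarrow> i \<noteq> j \<Longrightarrow> y \<in> left_beads Q j \<Longrightarrow> short_by q m Q (C i) y"
    and "x \<in> left_beads Q i \<Longrightarrow> short_by 0 m Q H x"
    and "x \<in> left_beads Q i \<Longrightarrow> short_by 1 m Q (C i) x"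
    and "j < m \<Longrightarrow> i \<noteq> j \<Longrightarrow> i \<noteq> Suc j mod m \<Longrightarrow> short_by 1 m Q (C i) (C j)"
proof -
  \<comment> \<open>Rotation by \<open>i + 1\<close> carries the last blob to blob \<open>i\<close>,
    as \<open>M + i + 1 = i + m\<close>.\<close>
  define s where "s = Suc i"
  have last: "(M + s) mod m = i" using rotate_index_last[OF i] by (simp only: s_def)
  note other = rotate_index_other[OF i, folded s_def]
  let ?Q = "\<lambda>k. Q ((k + s) mod m)"
  have Q': "sparse m ?Q" by (rule sparse_rotated[OF Q]) (use m in simp)
  have m0: "m > 0" using m by simp
  note rot = short_by_rotate[OF _ m0, of _ Q s]
  have left: "\<exists>x'\<in>left_beads ?Q k. x = rotate_bead m s x'" if "x \<in> left_beads Q ((k + s) mod m)" for x k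
    using that unfolding rotate_left_beads[symmetric] by blast
  have leftM: "\<exists>x'\<in>left_beads ?Q M. x = rotate_bead m s x'" if "x \<in> left_beads Q i" for x
    using left[of x M] that last by simp
  have C: "rotate_bead m s (C M) = C i" "rotate_bead m s H = H" "\<And>k. rotate_bead m s (C k) = C ((k + s) mod m)"
    using last by simp_all
  show "short_by 0 m Q x y" if ij: "j < m" "i \<noteq> j" and xy: "x \<in> left_beads Q i" "y \<in> left_beads Q j"
  proof -
    obtain j' where "j' < M" "j = (j' + s) mod m" using other[OF ij] .
    then show ?thesis using rot[OF short_by_last_blob(1)[OF Q', of j']] leftM[OF xy(1)] left[of y j'] xy(2) by auto
  qed
  show "short_by q m Q (C i) y" if q: "q \<le> 2" and ij: "j < m" "i \<noteq> j" and y: "y \<in> left_beads Q j"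
  proof -
    obtain j' where "j' < M" "j = (j' + s) mod m" using other[OF ij] .
    then show ?thesis
      using rot[OF short_by_last_blob(2)[OF Q', of q j'], unfolded C(1)] left[of y j'] q y by auto
  qed
  show "short_by 0 m Q H x" if "x \<in> left_beads Q i"
    using rot[OF short_by_last_blob(3)[OF Q'], unfolded C(2)] leftM[OF that] by auto
  show "short_by 1 m Q (C i) x" if "x \<in> left_beads Q i"
    using rot[OF short_by_last_blob(4)[OF Q'], unfolded C(1)] leftM[OF that] by auto
  show "short_by 1 m Q (C i) (C j)" if j: "j < m" "i \<noteq> j" "i \<noteq> Suc j mod m"
  proof -
    obtain j' where j': "j' < M" "j = (j' + s) mod m" using other[OF j(1,2)] .
    \<comment> \<open>Blob \<open>j'\<close> directly before the last one would mean, after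
      rotation, that \<open>i\<close> directly follows \<open>j\<close>.\<close>
    have "Suc j' \<noteq> M"
    proof
      assume "Suc j' = M"
      then have "Suc j mod m = (M + s) mod m"
        unfolding j'(2) by (simp add: mod_Suc_eq flip: add_Suc)
      then show False using last j(3) by simp
    qed
    then have "Suc j' < M" using j' by simp
    then show ?thesis
      using rot[OF short_by_last_blob(5)[OF Q'], unfolded C] j'(2) last by auto
  qed
qed

lemma short_by_blob_mirrored:
  assumes Q: "sparse m Q" and i: "i < m"
  shows "j < m \<Longrightarrow> i \<noteq> j \<Longrightarrow> x \<in> right_beads Q i \<Longrightarrow> y \<in> right_beads Q j \<Longrightarrow> short_by 0 m Q x y"
    and "q \<le> 2 \<Longrightarrow> j < m \<Longrightarrow> i \<noteq> j \<Longrightarrow> y \<in> right_beads Q j \<Longrightarrow> short_by q m Q (C i) y"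
    and "x \<in> right_beads Q i \<Longrightarrow> short_by 0 m Q H x"
    and "x \<in> right_beads Q i \<Longrightarrow> short_by 1 m Q (C i) x"
proof -
  let ?Q = "\<lambda>k. Q (m - 1 - k)"
  have Q': "sparse m ?Q" using sparse_mirrored[OF Q] .
  have i': "m - 1 - i < m" using m by simp
  have right: "\<exists>x'\<in>left_beads ?Q (m - 1 - k). x = mirror_bead m x'" if "k < m" "x \<in> right_beads Q k" for x k
    using that mirror_left_beads[of k m Q] by blast
  have C: "mirror_bead m (C (m - 1 - i)) = C i" "mirror_bead m H = H"
    using i by simp_all
  have ne: "m - 1 - j < m \<and> m - 1 - i \<noteq> m - 1 - j" if "j < m" "i \<noteq> j" for j
    using that i by auto
  show "short_by 0 m Q x y" if "j < m" "i \<noteq> j" "x \<in> right_beads Q i" "y \<in> right_beads Q j"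
    using short_by_mirror[OF short_by_blob(1)[OF Q' i', of "m - 1 - j"]] right[OF i that(3)] right[OF that(1,4)] ne[OF that(1,2)]
    by blast
  show "short_by q m Q (C i) y" if "q \<le> 2" "j < m" "i \<noteq> j" "y \<in> right_beads Q j"
    using short_by_mirror[OF short_by_blob(2)[OF Q' i', of q "m - 1 - j"]] right[OF that(2,4)] ne[OF that(2,3)] that(1)
    unfolding C by blast
  show "short_by 0 m Q H x" if "x \<in> right_beads Q i"
    using short_by_mirror[OF short_by_blob(3)[OF Q' i']] right[OF i that] unfolding C by blast
  show "short_by 1 m Q (C i) x" if "x \<in> right_beads Q i"
    using short_by_mirror[OF short_by_blob(4)[OF Q' i']] right[OF i that] unfolding C by blast
qed

text \<open>The direct construction fails only if \<open>i\<close> cyclically follows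
  \<open>j\<close>. With \<open>m \<ge> 8\<close> the two blobs cannot follow each other both ways,
  so then the ends are swapped.\<close>

lemma short_by_top_top:
  assumes "sparse m Q" "i < m" "j < m" "i \<noteq> j"
  shows "short_by 1 m Q (C i) (C j)"
proof (cases "i = Suc j mod m")
  case True
  then have "j \<noteq> Suc i mod m"
    using m assms(3) by (auto simp: mod_Suc split: if_splits)
  then show ?thesis
    using short_by_blob(5)[OF assms(1,3,2)] assms(4) short_by_rev by metis
next
  case False
  then show ?thesis using short_by_blob(5)[OF assms] by simp
qed

section \<open>Case analysis over the pairs of core vertices\<close>

lemma bead_kinds:
  assumes "x \<in> full m Q"
  obtains p where "p < m" "x = T p" | "x = H" | i where "i < m" "x = C i"
    | i where "i < m" "x \<in> left_beads Q i" | i where "i < m" "x \<in> right_beads Q i"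
  using assms by (cases x) (auto simp: necklace_simps left_beads_def right_beads_def)

lemma short_by_core:
  assumes Q: "sparse m Q" and x: "x \<in> full m Q" and y: "y \<in> full m Q"
    and col: "colour x \<noteq> colour y" and nadj: "\<not> adj m x y"
  shows "short_by 0 m Q x y"
proof -
  have nadj': "\<not> adj m y x" using nadj sympD[OF symp_adj] by blast
  have ne: "x \<noteq> y" using col by auto
  have H: "short_by 0 m Q H z" if "z \<in> full m Q" "colour z \<noteq> 0" "\<not> adj m H z" for z
    using that(1)
  proof (cases rule: bead_kinds)
    case (4 i) then show ?thesis using short_by_blob(3)[OF Q] by blast
  next
    case (5 i) then show ?thesis using short_by_blob_mirrored(3)[OF Q] by blast
  qed (use that in \<open>auto simp: adj_def\<close>)
  \<comment> \<open>Blobs are complete multipartite, so differently coloured non-adjacent beads lie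
    in different blobs.\<close>
  have same: "adj m u v" if "u \<in> left_beads Q i \<union> right_beads Q i \<union> {C i}"
    "v \<in> left_beads Q i \<union> right_beads Q i \<union> {C i}" "colour u \<noteq> colour v" for u v i
    using that by (auto simp: left_beads_def right_beads_def adj_def split: if_splits)
  have top: "short_by 0 m Q (C i) z" if "i < m" "z \<in> full m Q" "colour z \<noteq> 2" "\<not> adj m (C i) z" for i z
    using that(2)
  proof (cases rule: bead_kinds)
    case (1 p)
    have "short_by 0 m Q (T p) (C i)"
      by (rule short_by_T_nonadjacent[OF Q _ 1(1)]) (use that in \<open>auto simp: necklace_simps adj_def\<close>)
    then show ?thesis using 1(2) short_by_rev by simp
  next
    case (4 j)
    have "i \<noteq> j"
    proof
      assume "i = j"
      then have "adj m (C i) z" using same[of "C i" i z] 4(2) that(3) by auto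
      then show False using that(4) by simp
    qed
    then show ?thesis using short_by_blob(2)[OF Q that(1)] 4 by blast
  next
    case (5 j)
    have "i \<noteq> j"
    proof
      assume "i = j"
      then have "adj m (C i) z" using same[of "C i" i z] 5(2) that(3) by auto
      then show False using that(4) by simp
    qed
    then show ?thesis using short_by_blob_mirrored(2)[OF Q that(1)] 5 by blast
  qed (use that in \<open>auto simp: adj_def\<close>)
  show ?thesis
  proof (cases "\<exists>p. x = T p \<or> y = T p")
    case True
    then consider p where "x = T p" | p where "y = T p" by blast
    then show ?thesis
    proof cases
      case 1
      then show ?thesis
        using x y ne nadj by (intro short_by_T_nonadjacent[OF Q, of 0 p y, folded 1]) (auto simp: necklace_simps)
    next
      case 2
      then show ?thesis
        using x y ne nadj' by (intro short_by_rev[OF short_by_T_nonadjacent[OF Q, of 0 p x, folded 2]]) (auto simp: necklace_simps)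
    qed
  next
    case noT: False
    show ?thesis
    proof (cases "x = H \<or> y = H")
      case True
      then show ?thesis
      proof
        assume xH: "x = H"
        show ?thesis unfolding xH by (rule H) (use y col nadj xH in auto)
      next
        assume yH: "y = H"
        show ?thesis unfolding yH by (rule short_by_rev[OF H]) (use x col nadj' yH in auto)
      qed
    next
      case noH: False
      show ?thesis
      proof (cases "\<exists>i. x = C i \<or> y = C i")
        case True
        then consider i where "x = C i" | i where "y = C i" by blast
        then show ?thesis
        proof cases
          case 1
          show ?thesis unfolding 1 by (rule top) (use x y col nadj 1 in \<open>auto simp: necklace_simps\<close>)
        next
          case 2
          show ?thesis unfolding 2
            by (rule short_by_rev[OF top]) (use x y col nadj' 2 in \<open>auto simp: necklace_simps\<close>)
        qed
      next
        case noC: False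
        obtain i where i: "i < m" "x \<in> left_beads Q i \<or> x \<in> right_beads Q i"
          using x noT noH noC by (cases rule: bead_kinds) auto
        obtain j where j: "j < m" "y \<in> left_beads Q j \<or> y \<in> right_beads Q j"
          using y noT noH noC by (cases rule: bead_kinds) auto
        have ij: "i \<noteq> j" using same[of x i y] i j col nadj by auto
        \<comment> \<open>An \<open>A\<close> and a \<open>B\<close> share a colour, so they cannot
          occur together, and \<open>D\<close> and \<open>E\<close> count for both sides.\<close>
        have "x \<in> left_beads Q i \<and> y \<in> left_beads Q j \<or> x \<in> right_beads Q i \<and> y \<in> right_beads Q j"
          using i(2) j(2) col by (auto simp: left_beads_def right_beads_def split: if_splits)
        then show ?thesis
          using short_by_blob(1)[OF Q i(1) j(1) ij] short_by_blob_mirrored(1)[OF Q i(1) j(1) ij] by blast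
      qed
    qed
  qed
qed

text \<open>Serves the leaves of part 0, which hang at \<open>C 0\<close>; their possible new core
  neighbours have nonzero colour.\<close>

lemma short_by_top:
  assumes Q: "sparse m Q" and x: "x \<in> full m Q" "colour x \<noteq> 0" "x \<noteq> C i" and i: "i < m"
  shows "short_by 1 m Q (C i) x"
  using x(1)
proof (cases rule: bead_kinds)
  case (3 j)
  then show ?thesis using short_by_top_top[OF Q i] x by auto
next
  case (4 j)
  then show ?thesis
    using short_by_blob(2)[OF Q i, of 1 j] short_by_blob(4)[OF Q i] by (cases "i = j") auto
next
  case (5 j)
  then show ?thesis
    using short_by_blob_mirrored(2)[OF Q i, of 1 j] short_by_blob_mirrored(4)[OF Q i] by (cases "i = j") auto
next
  case (1 p)
  then show ?thesis using x(2) by simp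
next
  case 2
  then show ?thesis using x(2) by simp
qed

end

section \<open>Assembling the bound\<close>

lemma sat_cycle_le:
  assumes k: "3 \<le> k" "k \<le> m" and m: "m \<ge> 8" and r: "r \<le> 4" and n: "5 * m + 1 + r \<le> n"
  shows "sat (complete_multipartite k n) (cycle_graph (5 * m + 1 + r)) + (5 * m + 1 + r) \<le> 8 * m + 3 * r + k * n"
proof -
  let ?l = "5 * m + 1 + r"
  \<comment> \<open>The first \<open>r\<close> blobs receive the extra bead, which raises the order
    from \<open>5 * m + 1\<close> to exactly \<open>?l\<close>.\<close>
  define Q where "Q i \<longleftrightarrow> i < r" for i
  have "{i. i < m \<and> Q i} = {..<r}" using m r by (auto simp: Q_def)
  then have cQ: "card {i. i < m \<and> Q i} = r" by simp
  then have Q: "sparse m Q" using r by (simp add: sparse_def)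
  have card: "card (full m Q) = ?l" by (simp add: card_necklace cQ)
  obtain M where M: "m = Suc M" using m by (cases m) auto
  \<comment> \<open>Links have colour 0 and can host the leaves of every part but part 0, which are
    given to \<open>C 0\<close>. As \<open>k \<le> m\<close> there are enough links, and the hosts
    are pairwise non-adjacent, so paths with \<open>q = 2\<close> join them.\<close>
  define w where "w i = (if i = 0 then C 0 else T i)" for i :: nat
  have sb: "long_path (adj m) (full m Q) (?l - q) u v" if "short_by q m Q u v" for q u v
    using that unfolding short_by_def card .
  have "sat (complete_multipartite k n) (cycle_graph ?l) \<le>
      card {{x, y} | x y. x \<in> full m Q \<and> y \<in> full m Q \<and> adj m x y} + (k * n - ?l)"
  proof (rule sat_le_core[where col = colour and w = w])
    show "finite (full m Q)" by (rule finite_necklace)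
    show "card (full m Q) = ?l" by (rule card)
    show "\<not> hamiltonian_on (adj m) (full m Q)" using m by (intro not_hamiltonian_necklace) simp
    show "colour v < k" for v using k by (cases v) auto
    show "w i \<in> full m Q \<and> colour (w i) \<noteq> i" if "i < k" for i
      using that k by (auto simp: w_def necklace_simps)
    show "long_path (adj m) (full m Q) ?l x y"
      if "x \<in> full m Q" "y \<in> full m Q" "colour x \<noteq> colour y" "\<not> adj m x y" for x y
      using sb[OF short_by_core[OF M m Q that]] by simp
    show "long_path (adj m) (full m Q) (?l - 1) (w i) x"
      if "i < k" "x \<in> full m Q" "colour x \<noteq> i" "x \<noteq> w i" for i x
      using sb[of 1] short_by_T[OF M m Q, of i x] short_by_top[OF M m Q, of x 0] that k by (auto simp: w_def)
    show "long_path (adj m) (full m Q) (?l - 2) (w i) (w j)" if ij: "i < k" "j < k" "i \<noteq> j" for i j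
    proof -
      have far: "short_by 2 m Q (T p) (w q)" if "p < k" "q < k" "p \<noteq> q" "p \<noteq> 0" for p q
        using that k by (intro short_by_T_nonadjacent[OF M m Q]) (auto simp: w_def adj_def necklace_simps)
      have "short_by 2 m Q (w i) (w j)"
      proof (cases "i = 0")
        case True
        then show ?thesis using far[of j i] ij by (metis short_by_rev w_def)
      next
        case False
        then show ?thesis using far[of i j] ij by (simp add: w_def)
      qed
      then show ?thesis by (rule sb)
    qed
  qed (use n m symp_adj proper_colour in auto)
  also have "\<dots> \<le> 8 * m + 3 * r + (k * n - ?l)"
    using card_necklace_edges[of m "\<lambda>_. True" Q] cQ by simp
  finally have *: "sat (complete_multipartite k n) (cycle_graph ?l) \<le> 8 * m + 3 * r + (k * n - ?l)" .
  \<comment> \<open>Hence \<open>k * n\<close> is at least the order of the core and the subtraction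
    is not truncated.\<close>
  have "1 * n \<le> k * n" using k by (intro mult_right_mono) auto
  then show ?thesis using * n by linarith
qed

text \<open>The core gives at most \<open>k * n + 3 * m + 2 * r - 1\<close> edges, and the ceiling
  is at least \<open>m + 1\<close>. It remains that \<open>k + 2 * r \<le> 3 * m + 7\<close>, which
  follows from \<open>12 * k + 2 \<le> m\<close> and \<open>r \<le> 4\<close>. Starting at
  \<open>k = 3\<close> covers both halves of the theorem.\<close>

lemma sat_bound:
  assumes k: "k \<ge> 3" and l: "l \<ge> 60 * k + 12" and n: "n \<ge> l"
  shows "int (sat (complete_multipartite k n) (cycle_graph l)) \<le> int k * (int n - 1) + 6 * \<lceil>real l / 5\<rceil>"
proof -
  define m where "m = (l - 1) div 5"
  define r where "r = (l - 1) mod 5"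
  have l_eq: "l = 5 * m + 1 + r"
    using l by (simp add: m_def r_def)
  have r: "r \<le> 4" by (simp add: r_def)
  have m: "12 * k + 2 \<le> m" using l unfolding m_def by linarith
  have "sat (complete_multipartite k n) (cycle_graph l) + l \<le> 8 * m + 3 * r + k * n"
    using sat_cycle_le[of k m r n] k m r n unfolding l_eq by simp
  then have "int (sat (complete_multipartite k n) (cycle_graph l) + l) \<le> int (8 * m + 3 * r + k * n)"
    by (rule of_nat_mono)
  then have "int (sat (complete_multipartite k n) (cycle_graph l)) + int l \<le> 8 * int m + 3 * int r + int k * int n"
    by simp
  moreover have "int m < \<lceil>real l / 5\<rceil>"
    unfolding less_ceiling_iff by (simp add: l_eq)
  ultimately show ?thesis
    using m r l_eq by (simp add: right_diff_distrib)
qed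

theorem theorem1p10:
  "(\<forall>k\<ge>4. \<forall>l\<ge>60 * k + 12. \<forall>\<^sub>F n in sequentially.
      int (sat (complete_multipartite k n) (cycle_graph l))
        \<le> int k * (int n - 1) + 6 * \<lceil>real l / 5\<rceil>)
   \<and> (\<forall>l\<ge>60 * 3 + 12. \<forall>\<^sub>F n in sequentially.
      int (sat (complete_multipartite 3 n) (cycle_graph l))
        \<le> 3 * int n + 13 * \<lceil>real l / 5\<rceil>)"
proof (intro conjI allI impI)
  fix k l :: nat
  assume "4 \<le> k" "60 * k + 12 \<le> l"
  then show "\<forall>\<^sub>F n in sequentially. int (sat (complete_multipartite k n) (cycle_graph l))
      \<le> int k * (int n - 1) + 6 * \<lceil>real l / 5\<rceil>"
    using sat_bound by (intro eventually_sequentiallyI[of l]) simp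
next
  fix l :: nat
  assume l: "60 * 3 + 12 \<le> l"
  define c where "c = \<lceil>real l / 5\<rceil>"
  have "0 \<le> c" unfolding c_def by (simp add: zero_le_ceiling less_le_trans[of _ 0])
  \<comment> \<open>At \<open>k = 3\<close> the general bound is \<open>3 * n - 3 + 6 * c\<close>,
    which lies below the claimed one because \<open>c\<close> is nonnegative.\<close>
  then have "int 3 * (int n - 1) + 6 * c \<le> 3 * int n + 13 * c" for n :: nat
    by simp
  then show "\<forall>\<^sub>F n in sequentially. int (sat (complete_multipartite 3 n) (cycle_graph l))
      \<le> 3 * int n + 13 * \<lceil>real l / 5\<rceil>"
    using sat_bound[of 3 l] l unfolding c_def
    by (intro eventually_sequentiallyI[of l]) (meson order_refl order_trans)
qed

end
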